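(* Let $A\in\mathcal{K}$ be a Koch type set with base segment $A_{0,1}$. Then for every $\mathcal{H}^1$-measurable $C\subset A_{0,1}$, $$\mathcal{H}^1(\mathcal{F}(C))=\int_{C\setminus\Lambda_\infty^{-1}}\tilde\Pi\,d\mathcal{H}^1+\mathcal{H}^1(\mathcal{F}(C)\cap\Lambda_\infty).$$
   Context: A triangular cap on a segment is a closed solid isosceles triangle having that segment as base; its base angle is either of its two equal angles. Koch type sets: let $A_{0,1}\subset\mathbb{R}^2$ be a segment of finite positive length, and $T_{0,1}$ a triangular cap on it of height $\varepsilon\mathcal{H}^1(A_{0,1})$ with $0<\varepsilon<1/100$ and base angle $\theta_{0,1}$. Inductively, given caps $T_{n,i}$ on segments $A_{n,i}$ with base angles $\theta_{n,i}$ ($1\le i\le2^n$), let $A_{n+1,2i-1},A_{n+1,2i}$ be the two edges of $T_{n,i}$ other than its base, numbered so that $A_{n+1,1},\dots,A_{n+1,2^{n+1}}$ are consecutive segments of a polygonal curve joining the end points of $A_{0,1}$ (always starting from the same end point), and for $k\in\{2i-1,2i\}$ let $T_{n+1,k}\subset T_{n,i}$ be a triangular cap on $A_{n+1,k}$ with base angle $\theta_{n+1,k}\le\theta_{n,i}$. Let $B=\bigcap_{n=0}^\infty\bigcup_{i=1}^{2^n}T_{n,i}$ and let $E(B)$ be the (countable) set of all vertices of all $T_{n,i}$. A Koch type set is any set $A\in\{B,B\setminus E(B)\}$ arising in this way; $\mathcal{K}$ is the collection of all of them. Parametrisation: let $D_{n,1},\dots,D_{n,2^n}$ be the $2^n$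 consecutive closed subsegments of $A_{0,1}$ of equal length (numbered from the same end point), and $F_n:A_{0,1}\to\mathbb{R}^2$ the continuous map taking each $D_{n,i}$ affinely onto $A_{n,i}$ in the order-preserving way. The limit $\mathcal{F}=\lim_{n\to\infty}F_n$ exists pointwise and is a bijection of $A_{0,1}$ onto $B$ with $\mathcal{F}(D_{n,i})\subset T_{n,i}$. For $x\in B$ let $i(n,x)$ be the index $i$ with $x\in T_{n,i}$ (the larger one if there are two, which happens only for $x\in E(B)$), and $\tilde\Pi(x)=\prod_{n=0}^\infty(\cos\theta_{n,i(n,x)})^{-1}\in[1,\infty]$. For $t\in A_{0,1}$ write $\tilde\Pi(t):=\tilde\Pi(\mathcal{F}(t))$. Set $\Lambda_\infty=\{x\in A:\tilde\Pi(x)=\infty\}$ and $\Lambda_\infty^{-1}=\mathcal{F}^{-1}(\Lambda_\infty)\subset A_{0,1}$. *)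

theory Defs
  imports "HOL-Analysis.Analysis"
begin

section \<open>One-dimensional Hausdorff measure\<close>

text \<open>The covering sets are required to be bounded because the library's \<open>diameter\<close> of an unbounded
  set is an unspecified real number. The normalisation is the one giving a segment its length.\<close>

definition hausdorff1_pre :: "real \<Rightarrow> 'a::metric_space set \<Rightarrow> ennreal" where
  "hausdorff1_pre \<delta> S =
     (INF U \<in> {U :: nat \<Rightarrow> 'a set. S \<subseteq> (\<Union>k. U k) \<and> (\<forall>k. bounded (U k) \<and> diameter (U k) \<le> \<delta>)}.
        \<Sum>k. ennreal (diameter (U k)))"

definition hausdorff1 :: "'a::metric_space set \<Rightarrow> ennreal" where
  "hausdorff1 S = (SUP \<delta> \<in> {0<..}. hausdorff1_pre \<delta> S)"

text \<open>\<open>hausdorff1\<close> is an outer measure, defined on all sets; \<open>hausdorff1_measure\<close> is its restriction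
  to the sets that are measurable in the sense of Caratheodory.\<close>

definition hausdorff1_measure :: "'a::metric_space measure" where
  "hausdorff1_measure = measure_of UNIV (lambda_system UNIV UNIV hausdorff1) hausdorff1"

lemma hausdorff1_pre_antimono:
  assumes "d \<le> e"
  shows "hausdorff1_pre e S \<le> hausdorff1_pre d S"
  unfolding hausdorff1_pre_def by (rule INF_superset_mono) (use assms in \<open>auto intro: order_trans\<close>)

lemma hausdorff1_pre_mono: "S \<subseteq> T \<Longrightarrow> hausdorff1_pre d S \<le> hausdorff1_pre d T"
  unfolding hausdorff1_pre_def by (rule INF_superset_mono) auto

lemma hausdorff1_pre_le_hausdorff1: "0 < d \<Longrightarrow> hausdorff1_pre d S \<le> hausdorff1 S"
  unfolding hausdorff1_def by (rule SUP_upper) auto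

lemma hausdorff1_pre_empty:
  assumes "0 \<le> d"
  shows "hausdorff1_pre d {} = 0"
proof -
  have "hausdorff1_pre d {} \<le> (\<Sum>k::nat. ennreal (diameter ({} :: 'a set)))"
    unfolding hausdorff1_pre_def
    by (rule INF_lower2[of "\<lambda>_. {}"]) (use assms in auto)
  then show ?thesis by simp
qed

lemma hausdorff1_pre_countably_subadditive:
  fixes A :: "nat \<Rightarrow> 'a::metric_space set"
  shows "hausdorff1_pre d (\<Union>i. A i) \<le> (\<Sum>i. hausdorff1_pre d (A i))"
proof (rule ennreal_le_epsilon)
  fix e :: real
  assume fin: "(\<Sum>i. hausdorff1_pre d (A i)) < top" and e: "0 < e"
  let ?C = "\<lambda>S U. S \<subseteq> (\<Union>k::nat. U k) \<and> (\<forall>k. bounded (U k) \<and> diameter (U k) \<le> d)"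
  have "\<exists>U. ?C (A i) U \<and> (\<Sum>k. ennreal (diameter (U k)))
               \<le> hausdorff1_pre d (A i) + ennreal (e * (1/2) ^ Suc i)" for i
  proof -
    have "hausdorff1_pre d (A i) \<noteq> top"
      using fin ennreal_suminf_lessD[of "\<lambda>i. hausdorff1_pre d (A i)"] by (metis order_less_irrefl)
    then have "hausdorff1_pre d (A i) < hausdorff1_pre d (A i) + ennreal (e * (1/2) ^ Suc i)"
      using e by (simp add: ennreal_add_left_cancel_less)
    then obtain U where "U \<in> {U. ?C (A i) U}"
      "(\<Sum>k. ennreal (diameter (U k))) < hausdorff1_pre d (A i) + ennreal (e * (1/2) ^ Suc i)"
      unfolding hausdorff1_pre_def INF_less_iff by blast
    then show ?thesis by (auto intro: less_imp_le)
  qed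
  then obtain U where U: "\<And>i. ?C (A i) (U i)"
    and le: "\<And>i. (\<Sum>k. ennreal (diameter (U i k)))
               \<le> hausdorff1_pre d (A i) + ennreal (e * (1/2) ^ Suc i)"
    by metis
  define V where "V m = (case prod_decode m of (i, k) \<Rightarrow> U i k)" for m
  have "?C (\<Union>i. A i) V"
  proof (intro conjI allI)
    show "(\<Union>i. A i) \<subseteq> (\<Union>m. V m)"
    proof
      fix x assume "x \<in> (\<Union>i. A i)"
      then obtain i k where "x \<in> U i k" using U by blast
      then have "x \<in> V (prod_encode (i, k))" by (simp add: V_def)
      then show "x \<in> (\<Union>m. V m)" by blast
    qed
  qed (use U in \<open>auto simp: V_def split: prod.split\<close>)
  then have "hausdorff1_pre d (\<Union>i. A i) \<le> (\<Sum>m. ennreal (diameter (V m)))"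
    unfolding hausdorff1_pre_def by (intro INF_lower) auto
  also have "\<dots> = (\<Sum>i. \<Sum>k. ennreal (diameter (U i k)))"
  proof -
    have "(\<Sum>m. (\<lambda>(i, k). ennreal (diameter (U i k))) (prod_decode m))
            = (\<Sum>i. \<Sum>k. ennreal (diameter (U i k)))"
      using suminf_ennreal_2dimen[of "\<lambda>i. \<Sum>k. ennreal (diameter (U i k))"
          "\<lambda>(i, k). ennreal (diameter (U i k))"]
      by (simp add: o_def)
    moreover have "ennreal (diameter (V m)) = (\<lambda>(i, k). ennreal (diameter (U i k))) (prod_decode m)" for m
      by (simp add: V_def split: prod.split)
    ultimately show ?thesis by simp
  qed
  also have "\<dots> \<le> (\<Sum>i. hausdorff1_pre d (A i) + ennreal (e * (1/2) ^ Suc i))"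
    by (intro suminf_le le) auto
  also have "\<dots> = (\<Sum>i. hausdorff1_pre d (A i)) + (\<Sum>i. ennreal (e * (1/2) ^ Suc i))"
    by (rule suminf_add[symmetric]) auto
  also have "(\<Sum>i. ennreal (e * (1/2) ^ Suc i)) = ennreal e"
    using sums_mult[OF power_half_series, of e] e by (intro suminf_ennreal_eq) auto
  finally show "hausdorff1_pre d (\<Union>i. A i) \<le> (\<Sum>i. hausdorff1_pre d (A i)) + ennreal e" .
qed

lemma outer_measure_hausdorff1: "outer_measure_space UNIV (hausdorff1 :: 'a::metric_space set \<Rightarrow> ennreal)"
  unfolding outer_measure_space_def
proof (intro conjI)
  show "positive UNIV (hausdorff1 :: 'a set \<Rightarrow> ennreal)"
    unfolding positive_def hausdorff1_def by (auto simp: hausdorff1_pre_empty)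
  show "increasing UNIV (hausdorff1 :: 'a set \<Rightarrow> ennreal)"
    unfolding increasing_def hausdorff1_def by (auto intro!: SUP_mono' hausdorff1_pre_mono)
  show "countably_subadditive UNIV (hausdorff1 :: 'a set \<Rightarrow> ennreal)"
    unfolding countably_subadditive_def
  proof safe
    fix A :: "nat \<Rightarrow> 'a set"
    show "hausdorff1 (\<Union>i. A i) \<le> (\<Sum>i. hausdorff1 (A i))"
      unfolding hausdorff1_def[of "\<Union>i. A i"]
    proof (rule SUP_least)
      fix d :: real assume "d \<in> {0<..}"
      then show "hausdorff1_pre d (\<Union>i. A i) \<le> (\<Sum>i. hausdorff1 (A i))"
        by (intro order_trans[OF hausdorff1_pre_countably_subadditive] suminf_le
            hausdorff1_pre_le_hausdorff1) auto
    qed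
  qed
qed

lemma measure_space_hausdorff1:
  "measure_space UNIV (lambda_system UNIV UNIV hausdorff1) (hausdorff1 :: 'a::metric_space set \<Rightarrow> ennreal)"
  using sigma_algebra.caratheodory_lemma[OF sigma_algebra_Pow[of UNIV]] outer_measure_hausdorff1
  by simp

lemma sets_hausdorff1_measure:
  "sets hausdorff1_measure = lambda_system UNIV UNIV (hausdorff1 :: 'a::metric_space set \<Rightarrow> ennreal)"
  using measure_space_hausdorff1 unfolding hausdorff1_measure_def measure_space_def
  by (metis sigma_algebra.sets_measure_of_eq)

lemma space_hausdorff1_measure [simp]: "space hausdorff1_measure = UNIV"
  by (simp add: hausdorff1_measure_def)

lemma emeasure_hausdorff1_measure:
  assumes "S \<in> sets hausdorff1_measure"
  shows "emeasure hausdorff1_measure S = hausdorff1 S"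
  using assms measure_space_hausdorff1[where 'a = 'a] unfolding sets_hausdorff1_measure
  unfolding hausdorff1_measure_def measure_space_def
  by (intro emeasure_measure_of_sigma) auto


section \<open>Koch type sets\<close>

text \<open>\<open>p\<close> is the apex of a triangular cap \<open>convex hull {a, b, p}\<close> on the segment from \<open>a\<close> to \<open>b\<close>.\<close>

definition is_cap_apex :: "real^2 \<Rightarrow> real^2 \<Rightarrow> real^2 \<Rightarrow> bool" where
  "is_cap_apex a b p \<longleftrightarrow> \<not> collinear {a, b, p} \<and> dist p a = dist p b"

definition vertex_angle :: "real^2 \<Rightarrow> real^2 \<Rightarrow> real^2 \<Rightarrow> real" where
  "vertex_angle b a c = arccos (((b - a) \<bullet> (c - a)) / (norm (b - a) * norm (c - a)))"

text \<open>A construction is encoded by the vertices of its polygonal curves: \<open>z n 0, \<dots>, z n (2 ^ n)\<close> are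
  the consecutive vertices of the \<open>n\<close>-th curve. Thus, for \<open>1 \<le> i \<le> 2 ^ n\<close>, the \<open>i\<close>-th segment joins
  \<open>z n (i - 1)\<close> to \<open>z n i\<close>, and the apex of the cap on it is the vertex \<open>z (n + 1) (2 * i - 1)\<close> of the
  next curve. Values \<open>z n i\<close> with \<open>i > 2 ^ n\<close> play no role.\<close>

type_synonym koch_vertices = "nat \<Rightarrow> nat \<Rightarrow> real^2"

definition koch_segment :: "koch_vertices \<Rightarrow> nat \<Rightarrow> nat \<Rightarrow> (real^2) set" where
  "koch_segment z n i = closed_segment (z n (i - 1)) (z n i)"

definition koch_apex :: "koch_vertices \<Rightarrow> nat \<Rightarrow> nat \<Rightarrow> real^2" where
  "koch_apex z n i = z (Suc n) (2 * i - 1)"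

definition koch_cap :: "koch_vertices \<Rightarrow> nat \<Rightarrow> nat \<Rightarrow> (real^2) set" where
  "koch_cap z n i = convex hull {z n (i - 1), z n i, koch_apex z n i}"

definition koch_angle :: "koch_vertices \<Rightarrow> nat \<Rightarrow> nat \<Rightarrow> real" where
  "koch_angle z n i = vertex_angle (z n i) (z n (i - 1)) (koch_apex z n i)"

definition koch_construction :: "koch_vertices \<Rightarrow> bool" where
  "koch_construction z \<longleftrightarrow>
     z 0 0 \<noteq> z 0 1 \<and>
     (\<exists>\<epsilon>::real. 0 < \<epsilon> \<and> \<epsilon> < 1/100 \<and>
        ennreal (infdist (koch_apex z 0 1) (affine hull {z 0 0, z 0 1}))
          = ennreal \<epsilon> * hausdorff1 (koch_segment z 0 1)) \<and>
     (\<forall>n. \<forall>i\<in>{1..2^n}. is_cap_apex (z n (i - 1)) (z n i) (koch_apex z n i)) \<and>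
     (\<forall>n. \<forall>i\<in>{0..2^n}. z (Suc n) (2 * i) = z n i) \<and>
     (\<forall>n. \<forall>i\<in>{1..2^n}. \<forall>k\<in>{2 * i - 1, 2 * i}.
        koch_cap z (Suc n) k \<subseteq> koch_cap z n i \<and> koch_angle z (Suc n) k \<le> koch_angle z n i)"

definition koch_full_set :: "koch_vertices \<Rightarrow> (real^2) set" where
  "koch_full_set z = (\<Inter>n. \<Union>i\<in>{1..2^n}. koch_cap z n i)"

definition koch_exceptional_set :: "koch_vertices \<Rightarrow> (real^2) set" where
  "koch_exceptional_set z = (\<Union>n. \<Union>i\<in>{1..2^n}. {z n (i - 1), z n i, koch_apex z n i})"

definition koch_type_set :: "koch_vertices \<Rightarrow> (real^2) set \<Rightarrow> bool" where
  "koch_type_set z A \<longleftrightarrow>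
     koch_construction z \<and> A \<in> {koch_full_set z, koch_full_set z - koch_exceptional_set z}"


section \<open>Parametrisation and the function \<open>\<Pi>\<close>\<close>

text \<open>\<open>koch_div z n (i - 1)\<close> and \<open>koch_div z n i\<close> are the end points of the \<open>i\<close>-th of the \<open>2 ^ n\<close>
  equal subsegments of the base segment.\<close>

definition koch_div :: "koch_vertices \<Rightarrow> nat \<Rightarrow> nat \<Rightarrow> real^2" where
  "koch_div z n i = z 0 0 + (real i / 2^n) *\<^sub>R (z 0 1 - z 0 0)"

definition koch_approx :: "koch_vertices \<Rightarrow> nat \<Rightarrow> real^2 \<Rightarrow> real^2" where
  "koch_approx z n t = (THE y. \<exists>i\<in>{1..2^n}. \<exists>s\<in>{0..1}.
      t = (1 - s) *\<^sub>R koch_div z n (i - 1) + s *\<^sub>R koch_div z n i \<and>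
      y = (1 - s) *\<^sub>R z n (i - 1) + s *\<^sub>R z n i)"

lemma koch_approx_affine:
  assumes z: "z 0 0 \<noteq> z 0 1" and i: "i \<in> {1..2^n}" and s: "s \<in> {0..1}"
  shows "koch_approx z n ((1 - s) *\<^sub>R koch_div z n (i - 1) + s *\<^sub>R koch_div z n i)
           = (1 - s) *\<^sub>R z n (i - 1) + s *\<^sub>R z n i"
  unfolding koch_approx_def
proof (rule the_equality)
  have div: "(1 - s) *\<^sub>R koch_div z n (i - 1) + s *\<^sub>R koch_div z n i
      = z 0 0 + ((real i - 1 + s) / 2^n) *\<^sub>R (z 0 1 - z 0 0)" if "1 \<le> i" for i s
    using that by (simp add: koch_div_def of_nat_diff field_simps flip: scaleR_add_left)
  fix y
  assume "\<exists>j\<in>{1..2^n}. \<exists>r\<in>{0..1}.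
      (1 - s) *\<^sub>R koch_div z n (i - 1) + s *\<^sub>R koch_div z n i
        = (1 - r) *\<^sub>R koch_div z n (j - 1) + r *\<^sub>R koch_div z n j \<and>
      y = (1 - r) *\<^sub>R z n (j - 1) + r *\<^sub>R z n j"
  then obtain j r where j: "j \<in> {1..2^n}" and r: "r \<in> {0..1}"
    and eq: "(1 - s) *\<^sub>R koch_div z n (i - 1) + s *\<^sub>R koch_div z n i
        = (1 - r) *\<^sub>R koch_div z n (j - 1) + r *\<^sub>R koch_div z n j"
    and y: "y = (1 - r) *\<^sub>R z n (j - 1) + r *\<^sub>R z n j"
    by blast
  have "real i + s = real j + r"
    using eq z i j by (subst (asm) (1 2) div) auto
  moreover from this have "i = j \<or> i = Suc j \<or> j = Suc i"
    using r s by auto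
  ultimately consider "i = j" "s = r" | "i = Suc j" "s = 0" "r = 1" | "j = Suc i" "s = 1" "r = 0"
    using r s by auto
  then show "y = (1 - s) *\<^sub>R z n (i - 1) + s *\<^sub>R z n i"
    by cases (auto simp: y)
qed (use i s in blast)

definition koch_param :: "koch_vertices \<Rightarrow> real^2 \<Rightarrow> real^2" where
  "koch_param z t = lim (\<lambda>n. koch_approx z n t)"

definition koch_index :: "koch_vertices \<Rightarrow> nat \<Rightarrow> real^2 \<Rightarrow> nat" where
  "koch_index z n x = Max {i \<in> {1..2^n}. x \<in> koch_cap z n i}"

text \<open>The product is taken in \<open>ennreal\<close>, where all its factors are at least \<open>1\<close>; it may be infinite.\<close>

definition koch_Pi :: "koch_vertices \<Rightarrow> real^2 \<Rightarrow> ennreal" where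
  "koch_Pi z x = (\<Prod>n. ennreal (inverse (cos (koch_angle z n (koch_index z n x)))))"

definition koch_Lambda :: "koch_vertices \<Rightarrow> (real^2) set \<Rightarrow> (real^2) set" where
  "koch_Lambda z A = {x \<in> A. koch_Pi z x = \<infinity>}"

definition koch_Lambda_inv :: "koch_vertices \<Rightarrow> (real^2) set \<Rightarrow> (real^2) set" where
  "koch_Lambda_inv z A = {t \<in> koch_segment z 0 1. koch_param z t \<in> koch_Lambda z A}"

end

(* Let F be the parametrisation and Pi_n the product of the first n factors 1/cos; it is the ratio of
   the lengths of the n-th generation segment and of the corresponding dyadic cell of the base.  A
   cell is mapped into a cap of diameter Pi_n times the length of the cell, so F increases H^1 by a
   factor at most b on sets where Pi <= b.  Conversely, on a cell whose cap has base angle theta, F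
   expands distances at least by the factor (4 cos(theta) - 3)^2 Pi_n, and this constant tends to 1
   because the angles tend to 0 wherever Pi is finite.  Slicing the base segment by the values of Pi
   gives the upper bound for H^1(F(C)), monotone convergence along n gives the lower bound.
   No such comparison is available where Pi is infinite; these points are split off using that
   Borel sets are measurable for the outer measure H^1. *)
theory Submission
  imports Defs "HOL-Real_Asymp.Real_Asymp"
begin

section \<open>One-dimensional Hausdorff measure\<close>

text \<open>F(C) is never shown to be measurable for H^1. Additivity therefore always comes from the
  splitting set: the Caratheodory identity for Borel sets (caps without vertices, the set where Pi
  is infinite) is applied to an arbitrary set.

  The constant comes from the turn at an apex. With k = cos(theta), a child cap seen from the apex
  deviates from the direction of the parent's base by at most 2 theta. This costs the factor cos(2
  theta) = 2 k^2 - 1, against a gain of 1/k because each child is longer than half the base. The net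
  factor 2 k - 1/k is concave in k, and 4 k - 3 is its chord over [1/2, 1]. Two points on different
  sides of an apex pay once in their distances to the apex and once for the turn, whence the square.
  It does not accumulate over the generations: angles never increase, so the factor chosen at a cell
  serves all its descendants, and two points of a common child inherit the estimate without
  loss.\<close>

lemma dyadic_cell:
  fixes r :: real
  assumes "0 \<le> r" "r \<le> 1"
  obtains i s where "i \<in> {1..2 ^ n}" "s \<in> {0..1}" "r = (real i - 1 + s) / 2 ^ n"
proof (cases "r = 0")
  case True
  \<comment> \<open>The ceiling used below would give the index 0 here, so the left end point is put
    into the first cell by hand.\<close>
  then show ?thesis by (intro that[of 1 0]) auto
next
  case False
  define i where "i = nat \<lceil>r * 2 ^ n\<rceil>"
  have pos: "0 < r * 2 ^ n" using False assms by simp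
  have "real i = of_int \<lceil>r * 2 ^ n\<rceil>" using pos by (simp add: i_def)
  then have i: "real i - 1 \<le> r * 2 ^ n" "r * 2 ^ n \<le> real i"
    using ceiling_correct[of "r * 2 ^ n"] by linarith+
  have "\<lceil>r * 2 ^ n\<rceil> \<le> 2 ^ n" using assms by (simp add: ceiling_le_iff)
  then have "i \<in> {1..2 ^ n}"
    using pos by (auto simp: i_def nat_le_iff Suc_le_eq)
  then show ?thesis
    using i by (intro that[of i "r * 2 ^ n - real i + 1"]) (auto simp: field_simps)
qed

lemma diameter_le_dist:
  fixes S :: "'a::metric_space set"
  assumes "0 \<le> d" and "\<And>x y. x \<in> S \<Longrightarrow> y \<in> S \<Longrightarrow> dist x y \<le> d"
  shows "diameter S \<le> d"
  using assms by (auto simp: diameter_def intro!: cSUP_least)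

lemma dist_convex_hull_le:
  fixes S :: "'a::real_inner set"
  assumes "finite S" "\<And>u v. u \<in> S \<Longrightarrow> v \<in> S \<Longrightarrow> dist u v \<le> d"
    and "x \<in> convex hull S" "y \<in> convex hull S"
  shows "dist x y \<le> d"
proof -
  obtain u v where "u \<in> S" "v \<in> S" "norm (x - y) \<le> norm (u - v)"
    using simplex_extremal_le_exists[OF assms(1,3,4)] by auto
  then show ?thesis using assms(2)[of u v] by (simp add: dist_norm)
qed

lemma hausdorff1_mono: "S \<subseteq> T \<Longrightarrow> hausdorff1 S \<le> hausdorff1 T"
  using outer_measure_hausdorff1 by (auto simp: outer_measure_space_def increasing_def)

lemma hausdorff1_empty [simp]: "hausdorff1 {} = 0"
  using outer_measure_hausdorff1 by (auto simp: outer_measure_space_def positive_def)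

lemma hausdorff1_UN_le: "hausdorff1 (\<Union>i. A i) \<le> (\<Sum>i::nat. hausdorff1 (A i))"
  unfolding hausdorff1_def[of "\<Union>i. A i"]
proof (rule SUP_least)
  fix d :: real assume "d \<in> {0<..}"
  then show "hausdorff1_pre d (\<Union>i. A i) \<le> (\<Sum>i. hausdorff1 (A i))"
    by (intro order_trans[OF hausdorff1_pre_countably_subadditive] suminf_le
        hausdorff1_pre_le_hausdorff1) auto
qed

lemma hausdorff1_UN_finite_le:
  assumes "finite (J :: nat set)"
  shows "hausdorff1 (\<Union>i\<in>J. A i) \<le> (\<Sum>i\<in>J. hausdorff1 (A i))"
proof -
  let ?A = "\<lambda>i. if i \<in> J then A i else {}"
  have "hausdorff1 (\<Union>i\<in>J. A i) = hausdorff1 (\<Union>i. ?A i)"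
    by (rule arg_cong[of _ _ hausdorff1]) (auto split: if_splits)
  also have "\<dots> \<le> (\<Sum>i. hausdorff1 (?A i))" by (rule hausdorff1_UN_le)
  also have "\<dots> = (\<Sum>i\<in>J. hausdorff1 (?A i))" by (intro suminf_finite assms) auto
  finally show ?thesis by simp
qed

lemma hausdorff1_Un_le: "hausdorff1 (S \<union> T) \<le> hausdorff1 S + hausdorff1 T"
proof -
  have "S \<union> T = (\<Union>i\<in>{0, 1::nat}. if i = 0 then S else T)" by auto
  then show ?thesis
    using hausdorff1_UN_finite_le[of "{0, 1}" "\<lambda>i. if i = 0 then S else T"] by simp
qed

lemma hausdorff1_pre_le_finite_cover:
  assumes "finite (J :: nat set)" "S \<subseteq> (\<Union>i\<in>J. U i)" "0 \<le> d"
    and "\<And>i. i \<in> J \<Longrightarrow> bounded (U i) \<and> diameter (U i) \<le> d"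
  shows "hausdorff1_pre d S \<le> (\<Sum>i\<in>J. ennreal (diameter (U i)))"
proof -
  let ?U = "\<lambda>i. if i \<in> J then U i else {}"
  have "hausdorff1_pre d S \<le> (\<Sum>i. ennreal (diameter (?U i)))"
    unfolding hausdorff1_pre_def
    by (rule INF_lower) (use assms in \<open>auto split: if_splits\<close>)
  also have "\<dots> = (\<Sum>i\<in>J. ennreal (diameter (?U i)))" by (intro suminf_finite assms) auto
  finally show ?thesis by simp
qed

text \<open>A fixed scale \<open>e\<close> eventually exceeds \<open>d n\<close>, and passing to a
  coarser scale only decreases \<open>hausdorff1_pre\<close>.\<close>

lemma hausdorff1_le_limit:
  assumes "s \<longlonglongrightarrow> l" "d \<longlonglongrightarrow> 0" "\<And>n. hausdorff1_pre (d n) S \<le> ennreal (s n)"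
  shows "hausdorff1 S \<le> ennreal l"
  unfolding hausdorff1_def
proof (rule SUP_least)
  fix e :: real assume "e \<in> {0<..}"
  then have "\<forall>\<^sub>F n in sequentially. d n < e"
    using assms(2) by (intro order_tendstoD(2)) auto
  then have "\<forall>\<^sub>F n in sequentially. hausdorff1_pre e S \<le> ennreal (s n)"
    by (rule eventually_mono) (meson assms(3) hausdorff1_pre_antimono less_imp_le order_trans)
  then show "hausdorff1_pre e S \<le> ennreal l"
    using assms(1) by (intro tendsto_lowerbound[OF tendsto_ennrealI]) auto
qed

lemma hausdorff1_countable:
  assumes "countable S"
  shows "hausdorff1 S = 0"
proof (cases "S = {}")
  case False
  have sing: "hausdorff1 {x} = 0" for x :: 'a
  proof -
    have "hausdorff1 {x} \<le> ennreal 0"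
      by (rule hausdorff1_le_limit[of "\<lambda>_. 0" 0 "\<lambda>_. 0"])
        (use hausdorff1_pre_le_finite_cover[of "{0}" "{x}" "\<lambda>_. {x}" 0] in auto)
    then show ?thesis by simp
  qed
  have "S = (\<Union>i. {from_nat_into S i})"
    using range_from_nat_into[OF False assms] by (simp add: UNION_singleton_eq_range)
  then have "hausdorff1 S \<le> (\<Sum>i. hausdorff1 {from_nat_into S i})"
    using hausdorff1_UN_le[of "\<lambda>i. {from_nat_into S i}"] by simp
  then show ?thesis by (simp add: sing)
qed auto

lemma hausdorff1_Un_countable:
  assumes "countable N" "S \<subseteq> T \<union> N" "T \<subseteq> S"
  shows "hausdorff1 S = hausdorff1 T"
proof (rule antisym)
  have "hausdorff1 S \<le> hausdorff1 T + hausdorff1 N"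
    using hausdorff1_mono[OF assms(2)] hausdorff1_Un_le order_trans by blast
  then show "hausdorff1 S \<le> hausdorff1 T" by (simp add: hausdorff1_countable[OF assms(1)])
qed (rule hausdorff1_mono[OF assms(3)])

section \<open>Images under maps with metric estimates\<close>

text \<open>The hypothesis bounds the full measure of each piece of the image rather than its
  diameter, so covers at the single scale 1 suffice. This form suits a map whose best Lipschitz
  constant may exceed \<open>b\<close>.\<close>

lemma hausdorff1_image_le:
  fixes f :: "'a::metric_space \<Rightarrow> 'b::metric_space"
  assumes "0 < b" and f: "\<And>V. V \<subseteq> E \<Longrightarrow> bounded V \<Longrightarrow> hausdorff1 (f ` V) \<le> ennreal (b * diameter V)"
  shows "hausdorff1 (f ` E) \<le> ennreal b * hausdorff1 E"
proof -
  have "ennreal (1 / b) * hausdorff1 (f ` E) \<le> hausdorff1_pre 1 E"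
    unfolding hausdorff1_pre_def
  proof (rule INF_greatest)
    fix U :: "nat \<Rightarrow> 'a set"
    assume "U \<in> {U. E \<subseteq> (\<Union>k. U k) \<and> (\<forall>k. bounded (U k) \<and> diameter (U k) \<le> 1)}"
    then have U: "E \<subseteq> (\<Union>k. U k)" "\<And>k. bounded (U k)" by auto
    have "hausdorff1 (f ` E) \<le> hausdorff1 (\<Union>k. f ` (U k \<inter> E))"
      using U(1) by (intro hausdorff1_mono) blast
    also have "\<dots> \<le> (\<Sum>k. hausdorff1 (f ` (U k \<inter> E)))" by (rule hausdorff1_UN_le)
    also have "\<dots> \<le> (\<Sum>k. ennreal b * ennreal (diameter (U k)))"
    proof (intro suminf_le)
      fix k
      have "hausdorff1 (f ` (U k \<inter> E)) \<le> ennreal (b * diameter (U k \<inter> E))"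
        using U(2)[of k] by (intro f) (auto intro: bounded_subset)
      also have "\<dots> \<le> ennreal (b * diameter (U k))"
        using \<open>0 < b\<close> U(2)[of k] by (intro ennreal_leI mult_left_mono diameter_subset) auto
      finally show "hausdorff1 (f ` (U k \<inter> E)) \<le> ennreal b * ennreal (diameter (U k))"
        using \<open>0 < b\<close> by (simp add: ennreal_mult')
    qed auto
    also have "\<dots> = ennreal b * (\<Sum>k. ennreal (diameter (U k)))" by simp
    finally have "ennreal (1 / b) * hausdorff1 (f ` E)
        \<le> ennreal (1 / b) * (ennreal b * (\<Sum>k. ennreal (diameter (U k))))"
      by (rule mult_left_mono) auto
    also have "\<dots> = (\<Sum>k. ennreal (diameter (U k)))"
      using \<open>0 < b\<close> by (simp flip: mult.assoc ennreal_mult')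
    finally show "ennreal (1 / b) * hausdorff1 (f ` E) \<le> (\<Sum>k. ennreal (diameter (U k)))" .
  qed
  also have "\<dots> \<le> hausdorff1 E" by (rule hausdorff1_pre_le_hausdorff1) simp
  finally have "ennreal b * (ennreal (1 / b) * hausdorff1 (f ` E)) \<le> ennreal b * hausdorff1 E"
    by (rule mult_left_mono) auto
  then show ?thesis using \<open>0 < b\<close> by (simp flip: mult.assoc ennreal_mult')
qed

text \<open>The preimage of a covering set has at most 1 / c times its diameter, so scale
  \<open>c * d\<close> in the image corresponds to scale \<open>d\<close> in
  \<open>S\<close>.\<close>

lemma hausdorff1_image_ge:
  fixes f :: "'a::metric_space \<Rightarrow> 'b::metric_space"
  assumes "0 < c" and f: "\<And>x y. x \<in> S \<Longrightarrow> y \<in> S \<Longrightarrow> c * dist x y \<le> dist (f x) (f y)"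
  shows "ennreal c * hausdorff1 S \<le> hausdorff1 (f ` S)"
proof -
  have "ennreal c * hausdorff1_pre d S \<le> hausdorff1 (f ` S)" if "0 < d" for d
  proof -
    have "ennreal c * hausdorff1_pre d S \<le> hausdorff1_pre (c * d) (f ` S)"
      unfolding hausdorff1_pre_def[of "c * d"]
    proof (rule INF_greatest)
      fix U :: "nat \<Rightarrow> 'b set"
      assume "U \<in> {U. f ` S \<subseteq> (\<Union>k. U k) \<and> (\<forall>k. bounded (U k) \<and> diameter (U k) \<le> c * d)}"
      then have U: "f ` S \<subseteq> (\<Union>k. U k)" "\<And>k. bounded (U k)" "\<And>k. diameter (U k) \<le> c * d"
        by auto
      define V where "V k = {x \<in> S. f x \<in> U k}" for k
      have dist: "dist x y \<le> diameter (U k) / c" if "x \<in> V k" "y \<in> V k" for x y k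
        using f[of x y] diameter_bounded_bound[OF U(2), of "f x" k "f y"] that \<open>0 < c\<close>
        by (simp add: V_def field_simps)
      have bdd: "bounded (V k)" for k
        unfolding bounded_def by (metis dist)
      have diam: "diameter (V k) \<le> diameter (U k) / c" for k
        using \<open>0 < c\<close> by (intro diameter_le_dist) (auto simp: dist diameter_ge_0[OF U(2)])
      have "hausdorff1_pre d S \<le> (\<Sum>k. ennreal (diameter (V k)))"
        unfolding hausdorff1_pre_def
      proof (rule INF_lower, safe)
        fix x assume "x \<in> S" then show "x \<in> (\<Union>k. V k)" using U(1) by (auto simp: V_def)
      next
        fix k
        have "diameter (U k) / c \<le> d" using U(3)[of k] \<open>0 < c\<close> by (simp add: field_simps)
        then show "diameter (V k) \<le> d" using diam[of k] by linarith
      qed (rule bdd)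
      then have "ennreal c * hausdorff1_pre d S \<le> (\<Sum>k. ennreal c * ennreal (diameter (V k)))"
        by (simp add: mult_left_mono)
      also have "\<dots> \<le> (\<Sum>k. ennreal (diameter (U k)))"
      proof (intro suminf_le)
        fix k
        show "ennreal c * ennreal (diameter (V k)) \<le> ennreal (diameter (U k))"
          using diam[of k] \<open>0 < c\<close>
          by (subst ennreal_mult'[symmetric]) (auto simp: field_simps intro!: ennreal_leI)
      qed auto
      finally show "ennreal c * hausdorff1_pre d S \<le> (\<Sum>k. ennreal (diameter (U k)))" .
    qed
    also have "\<dots> \<le> hausdorff1 (f ` S)"
      using that \<open>0 < c\<close> by (intro hausdorff1_pre_le_hausdorff1) auto
    finally show ?thesis .
  qed
  then show ?thesis
    unfolding hausdorff1_def[of S] by (subst SUP_mult_left_ennreal) (auto intro!: SUP_least)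
qed

section \<open>Metric outer measures and Borel sets\<close>

text \<open>A monotone sequence of scales allows the supremum of a sum to be split into a sum of
  suprema in the next lemma.\<close>

lemma hausdorff1_SUP_sequence:
  assumes "0 < e"
  shows "hausdorff1 S = (SUP n. hausdorff1_pre (e / real (Suc n)) S)"
proof (rule antisym)
  show "hausdorff1 S \<le> (SUP n. hausdorff1_pre (e / real (Suc n)) S)"
    unfolding hausdorff1_def
  proof (rule SUP_least)
    fix d :: real assume "d \<in> {0<..}"
    then obtain n where "e / d < real n" using reals_Archimedean2 by blast
    then have "e / real (Suc n) \<le> d"
      using \<open>d \<in> {0<..}\<close> \<open>0 < e\<close> by (simp add: field_simps)
    then show "hausdorff1_pre d S \<le> (SUP n. hausdorff1_pre (e / real (Suc n)) S)"
      by (intro SUP_upper2[of n] hausdorff1_pre_antimono) auto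
  qed
qed (use assms in \<open>auto intro!: SUP_least hausdorff1_pre_le_hausdorff1\<close>)

text \<open>A covering set of diameter below \<open>e\<close> cannot meet both \<open>S\<close> and
  \<open>T\<close>, so a fine cover of the union falls apart into two covers.\<close>

lemma hausdorff1_Un_separated:
  fixes S T :: "'a::metric_space set"
  assumes "0 < e" and sep: "\<And>x y. x \<in> S \<Longrightarrow> y \<in> T \<Longrightarrow> e \<le> dist x y"
  shows "hausdorff1 S + hausdorff1 T \<le> hausdorff1 (S \<union> T)"
proof -
  \<comment> \<open>Half of \<open>e\<close>, so that already the first scale is strictly below the
    separation.\<close>
  let ?d = "\<lambda>n. e / 2 / real (Suc n)"
  have pre: "hausdorff1_pre d S + hausdorff1_pre d T \<le> hausdorff1_pre d (S \<union> T)"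
    if "0 < d" "d < e" for d
    unfolding hausdorff1_pre_def[of d "S \<union> T"]
  proof (rule INF_greatest)
    fix U :: "nat \<Rightarrow> 'a set"
    assume "U \<in> {U. S \<union> T \<subseteq> (\<Union>k. U k) \<and> (\<forall>k. bounded (U k) \<and> diameter (U k) \<le> d)}"
    then have U: "S \<union> T \<subseteq> (\<Union>k. U k)" "\<And>k. bounded (U k)" "\<And>k. diameter (U k) \<le> d"
      by auto
    define V where "V X k = (if U k \<inter> X = {} then {} else U k)" for X k
    have V: "hausdorff1_pre d X \<le> (\<Sum>k. ennreal (diameter (V X k)))" if X: "X \<subseteq> S \<union> T" for X
      unfolding hausdorff1_pre_def
    proof (rule INF_lower, safe)
      fix x assume "x \<in> X"
      then obtain k where "x \<in> U k" using X U(1) by blast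
      then have "x \<in> V X k" using \<open>x \<in> X\<close> by (auto simp: V_def)
      then show "x \<in> (\<Union>k. V X k)" by blast
    qed (use U \<open>0 < d\<close> in \<open>auto simp: V_def\<close>)
    have "V S k = {} \<or> V T k = {}" for k
    proof (rule ccontr)
      assume "\<not> ?thesis"
      then obtain x y where "x \<in> S" "x \<in> U k" "y \<in> T" "y \<in> U k"
        by (auto simp: V_def split: if_splits)
      then show False
        using sep[of x y] diameter_bounded_bound[OF U(2), of x k y] U(3)[of k] \<open>d < e\<close> by simp
    qed
    then have V_le: "ennreal (diameter (V S k)) + ennreal (diameter (V T k)) \<le> ennreal (diameter (U k))" for k
      by (metis V_def add.right_neutral add_0 diameter_empty ennreal_0 order_refl zero_le)
    have "hausdorff1_pre d S + hausdorff1_pre d T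
        \<le> (\<Sum>k. ennreal (diameter (V S k))) + (\<Sum>k. ennreal (diameter (V T k)))"
      by (intro add_mono V) auto
    also have "\<dots> = (\<Sum>k. ennreal (diameter (V S k)) + ennreal (diameter (V T k)))"
      by (rule suminf_add) auto
    also have "\<dots> \<le> (\<Sum>k. ennreal (diameter (U k)))"
      by (intro suminf_le V_le) auto
    finally show "hausdorff1_pre d S + hausdorff1_pre d T \<le> (\<Sum>k. ennreal (diameter (U k)))" .
  qed
  have inc: "incseq (\<lambda>n. hausdorff1_pre (?d n) X)" for X :: "'a set"
    using \<open>0 < e\<close> by (intro incseq_SucI hausdorff1_pre_antimono) (simp add: field_simps)
  have "hausdorff1 S + hausdorff1 T = (SUP n. hausdorff1_pre (?d n) S + hausdorff1_pre (?d n) T)"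
    using \<open>0 < e\<close> inc by (subst (1 2) hausdorff1_SUP_sequence[of "e / 2"]) (auto simp: ennreal_SUP_add)
  also have "\<dots> \<le> hausdorff1 (S \<union> T)"
  proof (rule SUP_least)
    fix n
    have d: "0 < ?d n" "?d n < e"
      using \<open>0 < e\<close> by (auto simp: field_simps intro: add_pos_nonneg)
    show "hausdorff1_pre (?d n) S + hausdorff1_pre (?d n) T \<le> hausdorff1 (S \<union> T)"
      using pre[OF d] hausdorff1_pre_le_hausdorff1[OF d(1)] order_trans by blast
  qed
  finally show ?thesis .
qed

text \<open>Caratheodory's criterion: the shells of points whose distance to \<open>F\<close> lies between
  \<open>1 / (n + 2)\<close> and \<open>1 / (n + 1)\<close> have summable measure, because every second one is separated
  from the others.\<close>

lemma closed_in_sets_hausdorff1: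
  fixes F :: "'a::metric_space set"
  assumes "closed F"
  shows "F \<in> sets hausdorff1_measure"
proof -
  have main: "hausdorff1 (X \<inter> F) + hausdorff1 (X - F) \<le> hausdorff1 X"
    if fin: "hausdorff1 X < top" and ne: "F \<noteq> {}" for X :: "'a set"
  proof -
    define A where "A n = {x \<in> X. 1 / real (Suc n) \<le> infdist x F}" for n
    define R where "R n = {x \<in> X. 1 / real (Suc (Suc n)) \<le> infdist x F
      \<and> infdist x F < 1 / real (Suc n)}" for n
    have lip: "infdist x F \<le> infdist y F + dist x y" for x y
      using infdist_triangle[of x F y] by simp
    have every_second: "(\<Sum>k<m. hausdorff1 (R (2 * k + j))) \<le> hausdorff1 (\<Union>k<m. R (2 * k + j))" for m j
    proof (induction m)
      case (Suc m)
      show ?case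
      \<comment> \<open>For \<open>m = 0\<close> there is just one shell, and the gap used below
        would divide by 0 if also \<open>j = 0\<close>.\<close>
      proof (cases "m = 0")
        case False
        then have pos: "0 < real (2 * m + j)" by simp
        \<comment> \<open>Shell \<open>2 * m + j\<close> is closer to \<open>F\<close> than
          \<open>1 / (2 * m + j + 1)\<close>, and the earlier shells of its parity are at least
          \<open>1 / (2 * m + j)\<close> away: skipping one shell leaves this gap.\<close>
        have "1 / real (2 * m + j + 1) < 1 / real (2 * m + j)"
          using pos by (intro divide_strict_left_mono) auto
        then have "0 < 1 / real (2 * m + j) - 1 / real (2 * m + j + 1)" by simp
        then have "hausdorff1 (\<Union>k<m. R (2 * k + j)) + hausdorff1 (R (2 * m + j))
          \<le> hausdorff1 ((\<Union>k<m. R (2 * k + j)) \<union> R (2 * m + j))"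
        proof (rule hausdorff1_Un_separated)
          fix x y assume "x \<in> (\<Union>k<m. R (2 * k + j))" and y: "y \<in> R (2 * m + j)"
          then obtain k where k: "k < m" and x: "x \<in> R (2 * k + j)" by blast
          have "1 / real (2 * m + j) \<le> 1 / real (Suc (Suc (2 * k + j)))"
            using k by (intro divide_left_mono) auto
          then show "1 / real (2 * m + j) - 1 / real (2 * m + j + 1) \<le> dist x y"
            using x y lip[of x y] by (simp add: R_def)
        qed
        then show ?thesis
          using Suc by (simp add: lessThan_Suc Un_commute add.commute) (meson add_left_mono order_trans)
      qed (simp add: lessThan_Suc)
    qed simp
    have half: "(\<Sum>k<m. hausdorff1 (R (2 * k + j))) \<le> hausdorff1 X" for m j
    proof -
      have "(\<Union>k<m. R (2 * k + j)) \<subseteq> X" by (auto simp: R_def)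
      then show ?thesis by (rule order_trans[OF every_second hausdorff1_mono])
    qed
    have split: "(\<Sum>k<2*m. hausdorff1 (R k))
        = (\<Sum>k<m. hausdorff1 (R (2 * k + 0))) + (\<Sum>k<m. hausdorff1 (R (2 * k + 1)))" for m
      by (induction m) (auto simp: algebra_simps)
    have "(\<Sum>k<m. hausdorff1 (R k)) \<le> hausdorff1 X + hausdorff1 X" for m
    proof -
      have "(\<Sum>k<m. hausdorff1 (R k)) \<le> (\<Sum>k<2*m. hausdorff1 (R k))"
        by (intro sum_mono2) auto
      also have "\<dots> \<le> hausdorff1 X + hausdorff1 X"
        unfolding split by (intro add_mono half)
      finally show ?thesis .
    qed
    then have "(\<Sum>k. hausdorff1 (R k)) \<le> hausdorff1 X + hausdorff1 X"
      by (intro suminf_le_const) auto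
    then have total: "(\<Sum>k. hausdorff1 (R k)) < top"
      using fin by (auto simp: less_top[symmetric] top_unique)
    have pos: "0 < infdist x F" if "x \<notin> F" for x
      using that assms ne by (simp add: infdist_pos_not_in_closed)
    \<comment> \<open>Adding the first \<open>n\<close> shells on both sides completes the tail to
      the full series. Its sum is finite and is cancelled at the end, which avoids subtraction in
      \<open>ennreal\<close>.\<close>
    have "(hausdorff1 (X \<inter> F) + hausdorff1 (X - F)) + (\<Sum>k<n. hausdorff1 (R k))
        \<le> hausdorff1 X + (\<Sum>k. hausdorff1 (R k))" for n
    proof -
      have "X - F \<subseteq> A n \<union> (\<Union>k. R (k + n))"
      proof
        fix x assume x: "x \<in> X - F"
        show "x \<in> A n \<union> (\<Union>k. R (k + n))"
        proof (cases "x \<in> A n")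
          case False
          define m where "m = (LEAST m. 1 / real (Suc m) \<le> infdist x F)"
          have "\<exists>m. 1 / real (Suc m) \<le> infdist x F"
            using nat_approx_posE[of "infdist x F"] pos[of x] x by (metis DiffD2 less_imp_le)
          then have m: "1 / real (Suc m) \<le> infdist x F" unfolding m_def by (rule LeastI_ex)
          have less: "infdist x F < 1 / real (Suc k)" if "k < m" for k
            using not_less_Least[of k "\<lambda>m. 1 / real (Suc m) \<le> infdist x F"] that
            unfolding m_def by simp
          have "infdist x F < 1 / real (Suc n)" using False x by (auto simp: A_def)
          then have "1 / real (Suc m) < 1 / real (Suc n)" using m by linarith
          then have "n < m" by (simp add: divide_simps split: if_splits)
          then obtain k where k: "m = Suc (k + n)"
            by (metis add.commute less_iff_Suc_add)
          then have "x \<in> R (k + n)" using m less[of "k + n"] x by (simp add: R_def)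
          then show ?thesis by blast
        qed simp
      qed
      then have "hausdorff1 (X - F) \<le> hausdorff1 (A n) + hausdorff1 (\<Union>k. R (k + n))"
        by (rule order_trans[OF hausdorff1_mono hausdorff1_Un_le])
      also have "\<dots> \<le> hausdorff1 (A n) + (\<Sum>k. hausdorff1 (R (k + n)))"
        by (intro add_left_mono hausdorff1_UN_le)
      finally have 1: "hausdorff1 (X - F) \<le> hausdorff1 (A n) + (\<Sum>k. hausdorff1 (R (k + n)))" .
      have "hausdorff1 (X \<inter> F) + hausdorff1 (A n) \<le> hausdorff1 ((X \<inter> F) \<union> A n)"
      proof (rule hausdorff1_Un_separated[of "1 / real (Suc n)"])
        fix x y assume "x \<in> X \<inter> F" "y \<in> A n"
        then show "1 / real (Suc n) \<le> dist x y"
          using lip[of y x] by (simp add: A_def dist_commute)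
      qed simp
      also have "\<dots> \<le> hausdorff1 X" by (intro hausdorff1_mono) (auto simp: A_def)
      finally have 2: "hausdorff1 (X \<inter> F) + hausdorff1 (A n) \<le> hausdorff1 X" .
      have "(hausdorff1 (X \<inter> F) + hausdorff1 (X - F)) + (\<Sum>k<n. hausdorff1 (R k))
        \<le> (hausdorff1 (X \<inter> F) + (hausdorff1 (A n) + (\<Sum>k. hausdorff1 (R (k + n)))))
            + (\<Sum>k<n. hausdorff1 (R k))"
        by (intro add_mono 1) auto
      also have "\<dots> = (hausdorff1 (X \<inter> F) + hausdorff1 (A n)) + (\<Sum>k. hausdorff1 (R k))"
        by (subst suminf_offset[of "\<lambda>k. hausdorff1 (R k)" n]) (auto simp: ac_simps)
      also have "\<dots> \<le> hausdorff1 X + (\<Sum>k. hausdorff1 (R k))"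
        by (intro add_right_mono 2)
      finally show ?thesis .
    qed
    moreover have "(\<lambda>n. (hausdorff1 (X \<inter> F) + hausdorff1 (X - F)) + (\<Sum>k<n. hausdorff1 (R k)))
        \<longlonglongrightarrow> (hausdorff1 (X \<inter> F) + hausdorff1 (X - F)) + (\<Sum>k. hausdorff1 (R k))"
      by (intro tendsto_add tendsto_const summable_LIMSEQ) auto
    ultimately have "(hausdorff1 (X \<inter> F) + hausdorff1 (X - F)) + (\<Sum>k. hausdorff1 (R k))
        \<le> hausdorff1 X + (\<Sum>k. hausdorff1 (R k))"
      by (intro LIMSEQ_le_const2) auto
    then show ?thesis
      using total ennreal_add_left_cancel_le[of "\<Sum>k. hausdorff1 (R k)"]
      by (auto simp: add.commute[of _ "\<Sum>k. hausdorff1 (R k)"])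
  qed
  have "hausdorff1 (X \<inter> F) + hausdorff1 (X - F) = hausdorff1 X" for X :: "'a set"
  proof (rule antisym)
    show "hausdorff1 (X \<inter> F) + hausdorff1 (X - F) \<le> hausdorff1 X"
      using main[of X] by (cases "F = {}"; cases "hausdorff1 X = top") (auto simp: less_top)
    show "hausdorff1 X \<le> hausdorff1 (X \<inter> F) + hausdorff1 (X - F)"
      using hausdorff1_Un_le[of "X \<inter> F" "X - F"] by (simp add: Int_Diff_Un)
  qed
  then show ?thesis
    unfolding sets_hausdorff1_measure lambda_system_def
    by (auto simp: Int_commute Diff_eq Compl_eq_Diff_UNIV[symmetric])
qed

lemma borel_subset_hausdorff1: "sets borel \<subseteq> sets (hausdorff1_measure :: 'a::metric_space measure)"
proof -
  have "sigma_sets UNIV (Collect closed) \<subseteq> sets (hausdorff1_measure :: 'a measure)"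
    using sets.sigma_sets_subset[of "Collect closed" "hausdorff1_measure :: 'a measure"]
      closed_in_sets_hausdorff1 by auto
  then show ?thesis by (simp add: borel_eq_closed)
qed

text \<open>\<open>X\<close> is arbitrary, which matters later, when it is an image under the
  parametrisation.\<close>

lemma hausdorff1_split:
  fixes T :: "'a::metric_space set"
  assumes "T \<in> sets hausdorff1_measure"
  shows "hausdorff1 X = hausdorff1 (X \<inter> T) + hausdorff1 (X - T)"
proof -
  have "T \<in> lambda_system UNIV UNIV hausdorff1"
    using assms by (simp only: sets_hausdorff1_measure)
  then have "hausdorff1 (T \<inter> X) + hausdorff1 ((UNIV - T) \<inter> X) = hausdorff1 X"
    by (simp only: lambda_system_def mem_Collect_eq UNIV_I ball_UNIV)
  moreover have "T \<inter> X = X \<inter> T" "(UNIV - T) \<inter> X = X - T" by auto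
  ultimately show ?thesis by simp
qed

lemma hausdorff1_sum_Int:
  fixes T :: "nat \<Rightarrow> 'a::metric_space set"
  assumes "finite J" "\<And>i. i \<in> J \<Longrightarrow> T i \<in> sets hausdorff1_measure" "disjoint_family_on T J"
  shows "(\<Sum>i\<in>J. hausdorff1 (X \<inter> T i)) = hausdorff1 (X \<inter> (\<Union>i\<in>J. T i))"
  using assms
proof (induction J rule: finite_induct)
  case (insert j J)
  let ?U = "\<Union>i\<in>J. T i"
  have "T j \<inter> T i = {}" if "i \<in> J" for i
    using disjoint_family_onD[OF insert.prems(2), of j i] insert.hyps(2) that by auto
  then have disj: "T j \<inter> ?U = {}" by auto
  have "hausdorff1 (X \<inter> (\<Union>i\<in>insert j J. T i)) = hausdorff1 (X \<inter> (T j \<union> ?U))" by simp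
  also have "\<dots> = hausdorff1 (X \<inter> (T j \<union> ?U) \<inter> T j) + hausdorff1 (X \<inter> (T j \<union> ?U) - T j)"
    using insert.prems by (intro hausdorff1_split) auto
  also have "X \<inter> (T j \<union> ?U) \<inter> T j = X \<inter> T j" by auto
  also have "X \<inter> (T j \<union> ?U) - T j = X \<inter> ?U" using disj by auto
  also have "hausdorff1 (X \<inter> ?U) = (\<Sum>i\<in>J. hausdorff1 (X \<inter> T i))"
    using insert.prems by (intro insert.IH[symmetric]) (auto simp: disjoint_family_on_def)
  finally show ?case using insert.hyps by simp
qed (simp add: hausdorff1_countable)

text \<open>The height of the first cap is prescribed as a multiple of the measure of the base
  segment; \<open>kcos_base\<close> uses this bound to pass from the measure to the length.\<close>

lemma hausdorff1_closed_segment_le: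
  fixes a b :: "'a::real_inner"
  shows "hausdorff1 (closed_segment a b) \<le> ennreal (dist a b)"
proof -
  define p where "p n i = a + (real i / 2 ^ n) *\<^sub>R (b - a)" for n i :: nat
  have diam: "diameter (closed_segment (p n (i - 1)) (p n i)) \<le> dist a b / 2 ^ n" if i: "i \<in> {1..2^n}" for n i
  proof -
    have "dist x y \<le> dist a b / 2 ^ n"
      if xy: "x \<in> closed_segment (p n (i - 1)) (p n i)" "y \<in> closed_segment (p n (i - 1)) (p n i)" for x y
    proof -
      have "dist x y \<le> dist (p n (i - 1)) (p n i)"
        by (rule dist_convex_hull_le[OF _ _ xy[unfolded segment_convex_hull]]) (auto simp: dist_commute)
      also have "\<dots> = dist a b / 2 ^ n"
        using i by (simp add: p_def dist_norm norm_minus_commute of_nat_diff diff_divide_distrib flip: scaleR_diff_left)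
      finally show ?thesis .
    qed
    then show ?thesis by (intro diameter_le_dist) auto
  qed
  show ?thesis
  proof (rule hausdorff1_le_limit[of "\<lambda>_. dist a b" _ "\<lambda>n. dist a b / 2 ^ n"])
    show "(\<lambda>n. dist a b / 2 ^ n) \<longlonglongrightarrow> 0"
      using tendsto_mult[OF tendsto_const LIMSEQ_inverse_realpow_zero[of 2]] by (simp add: divide_inverse)
    fix n
    have "closed_segment a b \<subseteq> (\<Union>i\<in>{1..2^n}. closed_segment (p n (i - 1)) (p n i))"
    proof
      fix x assume "x \<in> closed_segment a b"
      then obtain u where u: "0 \<le> u" "u \<le> 1" "x = a + u *\<^sub>R (b - a)"
        by (auto simp: in_segment algebra_simps)
      then obtain i s where i: "i \<in> {1..2 ^ n}" "s \<in> {0..1}" "u = (real i - 1 + s) / 2 ^ n"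
        by (metis dyadic_cell)
      then have eq: "u = (1 - s) * ((real i - 1) / 2 ^ n) + s * (real i / 2 ^ n)"
        by (simp add: field_simps)
      have "x = (1 - s) *\<^sub>R p n (i - 1) + s *\<^sub>R p n i"
        using i(1) unfolding u(3) eq by (simp add: p_def of_nat_diff algebra_simps)
      then show "x \<in> (\<Union>i\<in>{1..2^n}. closed_segment (p n (i - 1)) (p n i))"
        using i by (auto simp: in_segment)
    qed
    then have "hausdorff1_pre (dist a b / 2 ^ n) (closed_segment a b)
      \<le> (\<Sum>i\<in>{1..2^n}. ennreal (diameter (closed_segment (p n (i - 1)) (p n i))))"
      using diam by (intro hausdorff1_pre_le_finite_cover) (auto intro: compact_imp_bounded[OF compact_segment])
    also have "\<dots> \<le> (\<Sum>i\<in>{1..(2::nat)^n}. ennreal (dist a b / 2 ^ n))"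
      by (intro sum_mono ennreal_leI diam) 
    also have "\<dots> = ennreal (dist a b)"
      by (simp add: ennreal_of_nat_eq_real_of_nat flip: ennreal_mult')
    finally show "hausdorff1_pre (dist a b / 2 ^ n) (closed_segment a b) \<le> ennreal (dist a b)" .
  qed simp
qed

section \<open>Isosceles triangles and caps\<close>

text \<open>Angles add, and cos(2 phi) = 2 k^2 - 1 for k = cos(phi). Both vectors are split along
  \<open>w\<close> and orthogonally to it: the parallel parts contribute at least k^2, and by
  Cauchy-Schwarz the orthogonal parts cost at most 1 - k^2.\<close>

lemma inner_ge_cone_trans:
  fixes v w u :: "'a::real_inner"
  assumes k: "0 \<le> k" and w: "w \<noteq> 0"
    and vw: "k * (norm v * norm w) \<le> v \<bullet> w" and wu: "k * (norm w * norm u) \<le> w \<bullet> u"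
  shows "(2 * k\<^sup>2 - 1) * (norm v * norm u) \<le> v \<bullet> u"
proof -
  define e where "e = w /\<^sub>R norm w"
  have e: "e \<bullet> e = 1" using w by (simp add: e_def dot_square_norm field_simps power2_eq_square)
  define \<alpha> where "\<alpha> = v \<bullet> e"
  define \<beta> where "\<beta> = e \<bullet> u"
  have \<alpha>: "k * norm v \<le> \<alpha>" and \<beta>: "k * norm u \<le> \<beta>"
    using vw wu w by (simp_all add: \<alpha>_def \<beta>_def e_def field_simps)
  have "norm (v - \<alpha> *\<^sub>R e) ^ 2 = norm v ^ 2 - \<alpha>\<^sup>2" "norm (u - \<beta> *\<^sub>R e) ^ 2 = norm u ^ 2 - \<beta>\<^sup>2"
    unfolding power2_norm_eq_inner
    using e by (simp_all add: inner_diff inner_commute \<alpha>_def \<beta>_def power2_eq_square)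
  moreover have "(k * norm v)\<^sup>2 \<le> \<alpha>\<^sup>2" "(k * norm u)\<^sup>2 \<le> \<beta>\<^sup>2"
    using \<alpha> \<beta> k by (auto intro!: power_mono)
  ultimately have bounds: "norm (v - \<alpha> *\<^sub>R e) ^ 2 \<le> (1 - k\<^sup>2) * norm v ^ 2"
    "norm (u - \<beta> *\<^sub>R e) ^ 2 \<le> (1 - k\<^sup>2) * norm u ^ 2"
    by (simp_all add: power_mult_distrib algebra_simps)
  then have "norm (v - \<alpha> *\<^sub>R e) ^ 2 * norm (u - \<beta> *\<^sub>R e) ^ 2
      \<le> ((1 - k\<^sup>2) * norm v ^ 2) * ((1 - k\<^sup>2) * norm u ^ 2)"
    by (intro mult_mono) (auto intro: order_trans[OF zero_le_power2])
  then have "(norm (v - \<alpha> *\<^sub>R e) * norm (u - \<beta> *\<^sub>R e)) ^ 2 \<le> ((1 - k\<^sup>2) * (norm v * norm u)) ^ 2"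
    by (simp add: power_mult_distrib power2_eq_square mult_ac)
  moreover have "0 \<le> (1 - k\<^sup>2) * (norm v * norm u)"
  proof (cases "v = 0")
    case False
    have "0 \<le> (1 - k\<^sup>2) * norm v ^ 2"
      by (rule order_trans[OF zero_le_power2 bounds(1)])
    then have "0 \<le> 1 - k\<^sup>2" using False by (simp add: zero_le_mult_iff)
    then show ?thesis by simp
  qed simp
  ultimately have "norm (v - \<alpha> *\<^sub>R e) * norm (u - \<beta> *\<^sub>R e) \<le> (1 - k\<^sup>2) * (norm v * norm u)"
    by (rule power2_le_imp_le)
  moreover have "\<bar>(v - \<alpha> *\<^sub>R e) \<bullet> (u - \<beta> *\<^sub>R e)\<bar> \<le> norm (v - \<alpha> *\<^sub>R e) * norm (u - \<beta> *\<^sub>R e)"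
    by (rule Cauchy_Schwarz_ineq2)
  moreover have "(v - \<alpha> *\<^sub>R e) \<bullet> (u - \<beta> *\<^sub>R e) = v \<bullet> u - \<alpha> * \<beta>"
    using e by (simp add: inner_diff \<alpha>_def \<beta>_def inner_commute algebra_simps)
  moreover have "(k * norm v) * (k * norm u) \<le> \<alpha> * \<beta>"
    using \<alpha> \<beta> k order_trans[OF mult_nonneg_nonneg \<alpha>] by (intro mult_mono) auto
  ultimately show ?thesis by (simp add: algebra_simps power2_eq_square)
qed

text \<open>The apex projects to the midpoint of the base.\<close>

lemma isosceles_inner:
  fixes a b p :: "'a::real_inner"
  assumes "dist p a = dist p b"
  shows "(p - b) \<bullet> (a - b) = (dist a b)\<^sup>2 / 2"
proof -
  have "(dist p a)\<^sup>2 = (dist p b)\<^sup>2" using assms by simp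
  then show ?thesis
    by (simp add: dist_norm power2_norm_eq_inner inner_diff inner_commute field_simps)
qed

text \<open>Here \<open>k\<close> is a lower bound for \<open>dist a b / (2 * dist p b)\<close>, the cosine of the base angle.\<close>

lemma isosceles_cone:
  fixes a b p :: "'a::real_inner"
  assumes iso: "dist p a = dist p b" and k: "k * (2 * dist p b) \<le> dist a b" "0 \<le> k" "k \<le> 1"
    and x: "x \<in> convex hull {a, b, p}"
  shows "k * (norm (x - b) * norm (a - b)) \<le> (x - b) \<bullet> (a - b)"
proof -
  define K where "K = {x. k * (norm (x - b) * norm (a - b)) \<le> (x - b) \<bullet> (a - b)}"
  \<comment> \<open>\<open>K\<close> is the cone at \<open>b\<close> around \<open>a - b\<close>;
    being convex, it contains the triangle as soon as it contains the three vertices.\<close>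
  have "convex K"
  proof (rule convexI)
    fix x y and u v :: real
    assume xy: "x \<in> K" "y \<in> K" and uv: "0 \<le> u" "0 \<le> v" "u + v = 1"
    have eq: "u *\<^sub>R x + v *\<^sub>R y - b = u *\<^sub>R (x - b) + v *\<^sub>R (y - b)"
      using uv by (simp add: algebra_simps flip: scaleR_add_left)
    have "norm (u *\<^sub>R (x - b) + v *\<^sub>R (y - b)) \<le> u * norm (x - b) + v * norm (y - b)"
      using uv norm_triangle_ineq[of "u *\<^sub>R (x - b)" "v *\<^sub>R (y - b)"] by simp
    then have "k * (norm (u *\<^sub>R (x - b) + v *\<^sub>R (y - b)) * norm (a - b))
      \<le> k * ((u * norm (x - b) + v * norm (y - b)) * norm (a - b))"
      using k by (intro mult_left_mono mult_right_mono) auto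
    also have "\<dots> = u * (k * (norm (x - b) * norm (a - b))) + v * (k * (norm (y - b) * norm (a - b)))"
      by (simp add: algebra_simps)
    also have "\<dots> \<le> u * ((x - b) \<bullet> (a - b)) + v * ((y - b) \<bullet> (a - b))"
      using xy uv by (intro add_mono mult_left_mono) (auto simp: K_def)
    also have "\<dots> = (u *\<^sub>R (x - b) + v *\<^sub>R (y - b)) \<bullet> (a - b)"
      by (simp add: inner_add_left)
    finally show "u *\<^sub>R x + v *\<^sub>R y \<in> K" by (simp add: K_def eq)
  qed
  moreover have "k * (norm (p - b) * norm (a - b)) \<le> (p - b) \<bullet> (a - b)"
  proof -
    have "(k * (2 * norm (p - b))) * norm (a - b) \<le> norm (a - b) * norm (a - b)"
      using k by (intro mult_right_mono) (auto simp: dist_norm)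
    then show ?thesis
      unfolding isosceles_inner[OF iso] by (simp add: dist_norm power2_eq_square)
  qed
  moreover have "k * (norm (a - b) * norm (a - b)) \<le> (a - b) \<bullet> (a - b)"
    using k by (simp add: mult_left_le_one_le dot_square_norm power2_eq_square mult_right_le_one_le)
  ultimately have "convex hull {a, b, p} \<subseteq> K"
    by (intro hull_minimal) (auto simp: K_def)
  then show ?thesis using x by (auto simp: K_def)
qed


lemma abs_inner_divide_norm_le:
  fixes x y :: "'a::real_inner"
  shows "\<bar>(x \<bullet> y) / (norm x * norm y)\<bar> \<le> 1"
proof (cases "x = 0 \<or> y = 0")
  case False
  then show ?thesis using Cauchy_Schwarz_ineq2[of x y] by (simp add: abs_mult)
qed auto

section \<open>Lengths, angles and caps of a fixed construction\<close>

locale koch =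
  fixes z :: koch_vertices
  assumes construction: "koch_construction z"
begin

abbreviation base :: real where
  "base \<equiv> dist (z 0 0) (z 0 1)"

abbreviation len :: "nat \<Rightarrow> nat \<Rightarrow> real" where
  "len n i \<equiv> dist (z n (i - 1)) (z n i)"

abbreviation apex :: "nat \<Rightarrow> nat \<Rightarrow> real^2" where
  "apex n i \<equiv> z (Suc n) (2 * i - 1)"

abbreviation kcos :: "nat \<Rightarrow> nat \<Rightarrow> real" where
  "kcos n i \<equiv> cos (koch_angle z n i)"

lemma base_pos: "0 < base"
  using construction by (simp add: koch_construction_def)

lemma apex_not_collinear: "i \<in> {1..2 ^ n} \<Longrightarrow> \<not> collinear {z n (i - 1), z n i, apex n i}"
  and apex_dist: "i \<in> {1..2 ^ n} \<Longrightarrow> dist (apex n i) (z n (i - 1)) = dist (apex n i) (z n i)"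
  using construction by (auto simp: koch_construction_def is_cap_apex_def koch_apex_def)

lemma z_double: "i \<le> 2 ^ n \<Longrightarrow> z (Suc n) (2 * i) = z n i"
  using construction by (simp add: koch_construction_def)

lemma z_left_child: "i \<in> {1..2 ^ n} \<Longrightarrow> z (Suc n) (2 * i - 1 - 1) = z n (i - 1)"
proof -
  assume "i \<in> {1..2 ^ n}"
  then have "i - 1 \<le> 2 ^ n" "2 * i - 1 - 1 = 2 * (i - 1)" by auto
  then show ?thesis using z_double[of "i - 1" n] by simp
qed

lemma cap_child:
  assumes "i \<in> {1..2 ^ n}" "k \<in> {2 * i - 1, 2 * i}"
  shows "koch_cap z (Suc n) k \<subseteq> koch_cap z n i" "koch_angle z (Suc n) k \<le> koch_angle z n i"
  using construction assms unfolding koch_construction_def by blast+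

lemma child_index:
  fixes i :: nat
  assumes "i \<in> {1..2 ^ n}"
  shows "2 * i - 1 \<in> {1..2 ^ Suc n}" "2 * i \<in> {1..2 ^ Suc n}"
  using assms by auto

lemma parent_index:
  fixes k :: nat
  assumes "k \<in> {1..2 ^ Suc n}"
  obtains i where "i \<in> {1..2 ^ n}" "k = 2 * i - 1 \<or> k = 2 * i"
proof
  show "(k + 1) div 2 \<in> {1..2 ^ n}" "k = 2 * ((k + 1) div 2) - 1 \<or> k = 2 * ((k + 1) div 2)"
    using assms by auto
qed

lemma len_pos:
  assumes "i \<in> {1..2 ^ n}"
  shows "0 < len n i"
proof -
  have "z n (i - 1) \<noteq> z n i" using apex_not_collinear[OF assms] by auto
  then show ?thesis by simp
qed

lemma apex_dist_pos:
  assumes "i \<in> {1..2 ^ n}"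
  shows "0 < dist (apex n i) (z n i)"
proof -
  have "apex n i \<noteq> z n i" using apex_not_collinear[OF assms] by (auto simp: insert_commute)
  then show ?thesis by simp
qed

lemma kcos_eq:
  assumes "i \<in> {1..2 ^ n}"
  shows "kcos n i = len n i / (2 * dist (apex n i) (z n i))"
proof -
  let ?a = "z n (i - 1)" and ?b = "z n i" and ?p = "apex n i"
  define c where "c = ((?b - ?a) \<bullet> (?p - ?a)) / (norm (?b - ?a) * norm (?p - ?a))"
  have "(?p - ?a) \<bullet> (?b - ?a) = (dist ?b ?a)\<^sup>2 / 2"
    using apex_dist[OF assms] by (intro isosceles_inner) simp
  then have c: "c = len n i / (2 * dist ?p ?b)"
    using len_pos[OF assms] apex_dist[OF assms] apex_dist_pos[OF assms]
    by (simp add: c_def dist_norm inner_commute norm_minus_commute power2_eq_square field_simps)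
  have "\<bar>c\<bar> \<le> 1" unfolding c_def by (rule abs_inner_divide_norm_le)
  then have "cos (arccos c) = c" by (intro cos_arccos_abs)
  then show ?thesis
    using c by (simp add: koch_angle_def vertex_angle_def koch_apex_def c_def)
qed

lemma kcos_mult:
  "i \<in> {1..2 ^ n} \<Longrightarrow> kcos n i * (2 * dist (apex n i) (z n i)) = len n i"
  using apex_dist_pos[of i n] by (simp add: kcos_eq)

lemma kcos_pos: "i \<in> {1..2 ^ n} \<Longrightarrow> 0 < kcos n i"
  using len_pos apex_dist_pos by (simp add: kcos_eq)

lemma len_left_child:
  assumes "i \<in> {1..2 ^ n}"
  shows "len (Suc n) (2 * i - 1) = len n i / (2 * kcos n i)"
  using z_left_child[OF assms] apex_dist[OF assms] len_pos[OF assms]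
  by (simp add: kcos_eq[OF assms] dist_commute)

lemma len_right_child:
  assumes "i \<in> {1..2 ^ n}"
  shows "len (Suc n) (2 * i) = len n i / (2 * kcos n i)"
  using assms z_double[of i n] len_pos[OF assms] by (simp add: kcos_eq[OF assms])

lemma kcos_child:
  assumes "i \<in> {1..2 ^ n}" "k \<in> {2 * i - 1, 2 * i}"
  shows "kcos n i \<le> kcos (Suc n) k"
proof -
  have bounds: "0 \<le> koch_angle z n i \<and> koch_angle z n i \<le> pi" if i: "i \<in> {1..2 ^ n}" for n i
  proof -
    let ?a = "z n (i - 1)" and ?b = "z n i" and ?p = "apex n i"
    define c where "c = ((?b - ?a) \<bullet> (?p - ?a)) / (norm (?b - ?a) * norm (?p - ?a))"
    have "\<bar>c\<bar> \<le> 1" unfolding c_def by (rule abs_inner_divide_norm_le)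
    then have "0 \<le> arccos c \<and> arccos c \<le> pi"
      by (intro conjI arccos_lbound arccos_ubound) (simp_all add: abs_le_iff)
    then show ?thesis
      by (simp add: koch_angle_def vertex_angle_def koch_apex_def c_def)
  qed
  have "k \<in> {1..2 ^ Suc n}" using assms child_index by auto
  then show ?thesis
    using cap_child(2)[OF assms] bounds[OF assms(1)] bounds[of k "Suc n"]
    by (intro cos_monotone_0_pi_le) auto
qed

text \<open>By Pythagoras, a height of at most 1/100 of the base gives legs of at most 100/198 of
  the base, and 100/198 is 1/2 divided by 99/100. The bound passes to all caps and keeps
  \<open>2 * k^2 - 1\<close> and \<open>4 * k - 3\<close> positive for their cosines
  \<open>k\<close>.\<close>

lemma kcos_base: "99 / 100 \<le> kcos 0 1"
proof -
  let ?a = "z 0 0" and ?b = "z 0 1" and ?p = "apex 0 1"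
  define m where "m = (1/2) *\<^sub>R (?a + ?b)"
  obtain \<epsilon> :: real where \<epsilon>: "0 < \<epsilon>" "\<epsilon> < 1/100"
    "ennreal (infdist ?p (affine hull {?a, ?b})) = ennreal \<epsilon> * hausdorff1 (closed_segment ?a ?b)"
    using construction by (auto simp: koch_construction_def koch_apex_def koch_segment_def)
  note \<epsilon>(3)
  also have "ennreal \<epsilon> * hausdorff1 (closed_segment ?a ?b) \<le> ennreal \<epsilon> * ennreal base"
    by (intro mult_left_mono hausdorff1_closed_segment_le) simp
  also have "\<dots> = ennreal (\<epsilon> * base)" using \<epsilon> by (simp add: ennreal_mult')
  finally have height: "infdist ?p (affine hull {?a, ?b}) \<le> \<epsilon> * base"
    using \<epsilon> by (simp add: ennreal_le_iff)
  have orth: "(?p - m) \<bullet> (?b - ?a) = 0"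
  proof -
    have "(?p - ?b) \<bullet> (?a - ?b) = (dist ?a ?b)\<^sup>2 / 2"
      using apex_dist[of 1 0] by (intro isosceles_inner) simp
    then show ?thesis
      by (simp add: m_def dist_norm power2_norm_eq_inner inner_diff inner_add inner_commute field_simps)
  qed
  \<comment> \<open>The midpoint \<open>m\<close> is the foot of the perpendicular from the apex, so
    it realises the distance to the line.\<close>
  have "dist ?p m \<le> dist ?p y" if y_in: "y \<in> affine hull {?a, ?b}" for y
  proof -
    obtain u v where "u + v = 1" and y: "y = u *\<^sub>R ?a + v *\<^sub>R ?b"
      using y_in unfolding affine_hull_2 by blast
    then have u: "u = 1 - v" by simp
    have "m - y = (1/2 - v) *\<^sub>R (?b - ?a)"
      unfolding y u m_def by (simp add: algebra_simps flip: scaleR_add_left)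
    then have "(?p - m) \<bullet> (m - y) = 0" using orth by simp
    then have "(norm (?p - y))\<^sup>2 = (norm (?p - m))\<^sup>2 + (norm (m - y))\<^sup>2"
      using norm_add_Pythagorean[of "?p - m" "m - y"] by (simp add: orthogonal_def)
    then have "(norm (?p - m))\<^sup>2 \<le> (norm (?p - y))\<^sup>2" by simp
    then show ?thesis unfolding dist_norm by (rule power2_le_imp_le) simp
  qed
  then have "dist ?p m \<le> infdist ?p (affine hull {?a, ?b})"
    unfolding infdist_def by (auto intro!: cINF_greatest)
  then have "dist ?p m \<le> base / 100"
    using height \<epsilon> base_pos mult_right_mono[of \<epsilon> "1/100" base] by linarith
  then have pm: "(dist ?p m)\<^sup>2 \<le> (base / 100)\<^sup>2" by (intro power_mono) auto
  have mb: "m - ?b = (-1/2) *\<^sub>R (?b - ?a)" by (simp add: m_def algebra_simps flip: scaleR_add_left)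
  then have "(?p - m) \<bullet> (m - ?b) = 0" using orth by simp
  then have "(dist ?p ?b)\<^sup>2 = (dist ?p m)\<^sup>2 + (norm (m - ?b))\<^sup>2"
    using norm_add_Pythagorean[of "?p - m" "m - ?b"] by (simp add: orthogonal_def dist_norm)
  also have "norm (m - ?b) = base / 2" unfolding mb by (simp add: dist_norm norm_minus_commute)
  finally have "(dist ?p ?b)\<^sup>2 \<le> (base / 100)\<^sup>2 + (base / 2)\<^sup>2" using pm by simp
  also have "\<dots> \<le> (base * (100/198))\<^sup>2"
    by (simp add: power_divide power_mult_distrib)
  finally have "dist ?p ?b \<le> base * (100/198)"
    by (rule power2_le_imp_le) simp
  then show ?thesis
    using apex_dist_pos[of 1 0] by (simp add: kcos_eq field_simps)
qed

lemma kcos_ge: "i \<in> {1..2 ^ n} \<Longrightarrow> 99 / 100 \<le> kcos n i"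
proof (induction n arbitrary: i)
  case 0
  then show ?case using kcos_base by simp
next
  case (Suc n)
  obtain j where "j \<in> {1..2 ^ n}" "i = 2 * j - 1 \<or> i = 2 * j"
    using parent_index[OF Suc.prems] .
  then show ?case
    using Suc.IH[of j] kcos_child[of j n i] by simp
qed

text \<open>\<open>2 / 3\<close> is a crude bound for \<open>1 / (2 * kcos n i)\<close>; convergence
  and continuity only ask for a ratio below 1.\<close>

lemma len_le: "i \<in> {1..2 ^ n} \<Longrightarrow> len n i \<le> base * (2 / 3) ^ n"
proof (induction n arbitrary: i)
  case (Suc n)
  obtain j where j: "j \<in> {1..2 ^ n}" "i = 2 * j - 1 \<or> i = 2 * j"
    using parent_index[OF Suc.prems] .
  then have "len (Suc n) i = len n j / (2 * kcos n j)"
    using len_left_child[OF j(1)] len_right_child[OF j(1)] by metis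
  also have "\<dots> \<le> len n j / (3 / 2)"
    using kcos_ge[OF j(1)] by (intro divide_left_mono) auto
  also have "\<dots> \<le> base * (2 / 3) ^ Suc n" using Suc.IH[OF j(1)] by simp
  finally show ?case .
qed auto

lemma dist_cap_le:
  assumes i: "i \<in> {1..2 ^ n}" and xy: "x \<in> koch_cap z n i" "y \<in> koch_cap z n i"
  shows "dist x y \<le> len n i"
proof (rule dist_convex_hull_le[OF _ _ xy[unfolded koch_cap_def koch_apex_def]])
  \<comment> \<open>A base angle with cosine at least 1/2 makes the legs no longer than the base, so
    distances in the cap are bounded by the base.\<close>
  have "dist (apex n i) (z n i) \<le> len n i"
  proof -
    have "99 / 100 * (2 * dist (apex n i) (z n i)) \<le> kcos n i * (2 * dist (apex n i) (z n i))"
      using kcos_ge[OF i] by (intro mult_right_mono) auto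
    then show ?thesis using len_pos[OF i] unfolding kcos_mult[OF i] by linarith
  qed
  then show "dist u v \<le> len n i" 
    if "u \<in> {z n (i - 1), z n i, apex n i}" "v \<in> {z n (i - 1), z n i, apex n i}" for u v
    using that apex_dist[OF i] len_pos[OF i] by (elim insertE emptyE) (simp_all add: dist_commute)
qed simp

lemma cap_closed: "closed (koch_cap z n i)"
  unfolding koch_cap_def by (intro compact_imp_closed finite_imp_compact_convex_hull) simp

lemma vertices_in_cap:
  "z n (i - 1) \<in> koch_cap z n i" "z n i \<in> koch_cap z n i" "apex n i \<in> koch_cap z n i"
  unfolding koch_cap_def koch_apex_def by (auto intro: hull_inc)

text \<open>Seen from the apex, the child cap deviates from its own base by at most its base angle,
  hence by at most that of the parent, and its base makes the parent's base angle with the parent's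
  base. \<open>inner_ge_cone_trans\<close> combines the two turns.\<close>

lemma cone_left_child:
  assumes i: "i \<in> {1..2 ^ n}" and x: "x \<in> koch_cap z (Suc n) (2 * i - 1)"
  shows "(2 * (kcos n i)\<^sup>2 - 1) * (norm (x - apex n i) * len n i)
    \<le> (x - apex n i) \<bullet> (z n (i - 1) - z n i)"
proof -
  let ?a = "z n (i - 1)" and ?b = "z n i" and ?p = "apex n i" and ?k = "kcos n i"
  let ?q = "apex (Suc n) (2 * i - 1)"
  have j: "2 * i - 1 \<in> {1..2 ^ Suc n}" using child_index[OF i] by simp
  have k: "0 < ?k" "?k \<le> 1" using kcos_pos[OF i] by auto
  have le: "?k \<le> kcos (Suc n) (2 * i - 1)" using kcos_child[OF i] by simp
  have z': "z (Suc n) (2 * i - 1 - 1) = ?a" using z_left_child[OF i] .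
  have "?k * (norm (x - ?p) * norm (?a - ?p)) \<le> (x - ?p) \<bullet> (?a - ?p)"
  proof (rule isosceles_cone)
    show "dist ?q ?a = dist ?q ?p" using apex_dist[OF j] z' by simp
    show "?k * (2 * dist ?q ?p) \<le> dist ?a ?p"
      using mult_right_mono[OF le, of "2 * dist ?q ?p"] kcos_mult[OF j] z' by simp
    show "x \<in> convex hull {?a, ?p, ?q}" using x z' by (simp add: koch_cap_def koch_apex_def)
  qed (use k in auto)
  moreover have "?k * (norm (?a - ?p) * norm (?a - ?b)) \<le> (?a - ?p) \<bullet> (?a - ?b)"
  proof -
    have "(?p - ?a) \<bullet> (?b - ?a) = (dist ?b ?a)\<^sup>2 / 2"
      using apex_dist[OF i] by (intro isosceles_inner) simp
    moreover have "(?a - ?p) \<bullet> (?a - ?b) = (?p - ?a) \<bullet> (?b - ?a)"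
      by (simp add: inner_diff algebra_simps)
    ultimately show ?thesis
      using apex_dist[OF i] apex_dist_pos[OF i]
      by (simp add: kcos_eq[OF i] dist_norm norm_minus_commute power2_eq_square)
  qed
  moreover have "?a - ?p \<noteq> 0" using apex_dist[OF i] apex_dist_pos[OF i] by auto
  ultimately show ?thesis
    using k inner_ge_cone_trans[of ?k "?a - ?p" "x - ?p" "?a - ?b"] by (simp add: dist_norm)
qed

lemma cone_right_child:
  assumes i: "i \<in> {1..2 ^ n}" and x: "x \<in> koch_cap z (Suc n) (2 * i)"
  shows "(2 * (kcos n i)\<^sup>2 - 1) * (norm (x - apex n i) * len n i)
    \<le> (x - apex n i) \<bullet> (z n i - z n (i - 1))"
proof -
  let ?a = "z n (i - 1)" and ?b = "z n i" and ?p = "apex n i" and ?k = "kcos n i"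
  let ?q = "apex (Suc n) (2 * i)"
  have j: "2 * i \<in> {1..2 ^ Suc n}" using child_index[OF i] by simp
  have k: "0 < ?k" "?k \<le> 1" using kcos_pos[OF i] by auto
  have le: "?k \<le> kcos (Suc n) (2 * i)" using kcos_child[OF i] by simp
  have z': "z (Suc n) (2 * i) = ?b" using z_double i by simp
  have "?k * (norm (x - ?p) * norm (?b - ?p)) \<le> (x - ?p) \<bullet> (?b - ?p)"
  proof (rule isosceles_cone)
    show eq: "dist ?q ?b = dist ?q ?p" using apex_dist[OF j] z' by simp
    show "?k * (2 * dist ?q ?p) \<le> dist ?b ?p"
      using mult_right_mono[OF le, of "2 * dist ?q ?p"] kcos_mult[OF j] z' eq by (simp add: dist_commute)
    show "x \<in> convex hull {?b, ?p, ?q}"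
      using x z' by (simp add: koch_cap_def koch_apex_def insert_commute)
  qed (use k in auto)
  moreover have "?k * (norm (?b - ?p) * norm (?b - ?a)) \<le> (?b - ?p) \<bullet> (?b - ?a)"
  proof -
    have "(?p - ?b) \<bullet> (?a - ?b) = (dist ?a ?b)\<^sup>2 / 2"
      using apex_dist[OF i] by (intro isosceles_inner) simp
    moreover have "(?b - ?p) \<bullet> (?b - ?a) = (?p - ?b) \<bullet> (?a - ?b)"
      by (simp add: inner_diff algebra_simps)
    ultimately show ?thesis
      using apex_dist_pos[OF i]
      by (simp add: kcos_eq[OF i] dist_norm norm_minus_commute power2_eq_square)
  qed
  moreover have "?b - ?p \<noteq> 0" using apex_dist_pos[OF i] by auto
  ultimately show ?thesis
    using k inner_ge_cone_trans[of ?k "?b - ?p" "x - ?p" "?b - ?a"]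
    by (simp add: dist_norm norm_minus_commute)
qed

section \<open>The parametrisation\<close>

abbreviation point :: "real \<Rightarrow> real^2" where
  "point r \<equiv> z 0 0 + r *\<^sub>R (z 0 1 - z 0 0)"

abbreviation param :: "real \<Rightarrow> real^2" where
  "param r \<equiv> koch_param z (point r)"

lemma koch_approx_point:
  assumes i: "i \<in> {1..2 ^ n}" and s: "s \<in> {0..1}"
  shows "koch_approx z n (point ((real i - 1 + s) / 2 ^ n)) = (1 - s) *\<^sub>R z n (i - 1) + s *\<^sub>R z n i"
proof -
  have "(1 - s) *\<^sub>R koch_div z n (i - 1) + s *\<^sub>R koch_div z n i = point ((real i - 1 + s) / 2 ^ n)"
    using i by (simp add: koch_div_def of_nat_diff field_simps flip: scaleR_add_left)
  then show ?thesis
    using koch_approx_affine[of z, OF _ i s] construction by (simp add: koch_construction_def)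
qed

text \<open>Here \<open>s\<close> is the relative position in cell \<open>i\<close> of level
  \<open>n\<close>, and \<open>m\<close> counts the levels below it. The two child recursions allow
  induction on \<open>m\<close>, with bounds independent of \<open>m\<close> that survive the
  limit.\<close>

definition level_point :: "nat \<Rightarrow> nat \<Rightarrow> nat \<Rightarrow> real \<Rightarrow> real^2" where
  "level_point m n i s = koch_approx z (n + m) (point ((real i - 1 + s) / 2 ^ n))"

lemma level_point_0:
  "i \<in> {1..2 ^ n} \<Longrightarrow> s \<in> {0..1} \<Longrightarrow> level_point 0 n i s = (1 - s) *\<^sub>R z n (i - 1) + s *\<^sub>R z n i"
  using koch_approx_point[of i n s] by (simp add: level_point_def)

lemma level_point_left:
  assumes "i \<in> {1..2 ^ n}"
  shows "level_point (Suc m) n i s = level_point m (Suc n) (2 * i - 1) (2 * s)"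
proof -
  have "(real (2 * i - 1) - 1 + 2 * s) / 2 ^ Suc n = (real i - 1 + s) / 2 ^ n"
    using assms by (simp add: of_nat_diff field_simps)
  then show ?thesis by (simp add: level_point_def)
qed

lemma level_point_right:
  "level_point (Suc m) n i s = level_point m (Suc n) (2 * i) (2 * s - 1)"
proof -
  have "(real (2 * i) - 1 + (2 * s - 1)) / 2 ^ Suc n = (real i - 1 + s) / 2 ^ n"
    by (simp add: field_simps)
  then show ?thesis by (simp add: level_point_def)
qed

lemma level_point_in_cap:
  "i \<in> {1..2 ^ n} \<Longrightarrow> s \<in> {0..1} \<Longrightarrow> level_point m n i s \<in> koch_cap z n i"
proof (induction m arbitrary: n i s)
  case 0
  have "convex (koch_cap z n i)" by (simp add: koch_cap_def convex_convex_hull)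
  then show ?case
    using 0 vertices_in_cap[where n = n and i = i] unfolding level_point_0[OF 0]
    by (auto intro!: convexD)
next
  case (Suc m)
  show ?case
  proof (cases "s \<le> 1 / 2")
    case True
    then have "level_point m (Suc n) (2 * i - 1) (2 * s) \<in> koch_cap z (Suc n) (2 * i - 1)"
      using Suc.prems child_index by (intro Suc.IH) auto
    then show ?thesis
      using cap_child(1)[OF Suc.prems(1), of "2 * i - 1"] level_point_left[OF Suc.prems(1)] by auto
  next
    case False
    then have "level_point m (Suc n) (2 * i) (2 * s - 1) \<in> koch_cap z (Suc n) (2 * i)"
      using Suc.prems child_index by (intro Suc.IH) auto
    then show ?thesis
      using cap_child(1)[OF Suc.prems(1), of "2 * i"] level_point_right by auto
  qed
qed

text \<open>With \<open>k\<close> the cosine of the base angle, the factor \<open>e\<close> in the estimates below can be taken to be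
  \<open>4 * k - 3\<close>, which tends to \<open>1\<close> with \<open>k\<close>.\<close>

lemma angle_loss:
  fixes e k :: real
  assumes "99 / 100 \<le> k" "k \<le> 1" "e \<le> 4 * k - 3"
  shows "e * k \<le> 2 * k\<^sup>2 - 1"
proof -
  \<comment> \<open>This product equals \<open>(2 * k^2 - 1) - (4 * k - 3) * k\<close>.\<close>
  have "0 \<le> (1 - k) * (2 * k - 1)" using assms by simp
  moreover have "e * k \<le> (4 * k - 3) * k" using assms by (intro mult_right_mono) auto
  ultimately show ?thesis by (simp add: power2_eq_square algebra_simps)
qed

text \<open>A point in the second half of the triangle lies in a cone at the apex around a side, so its
  distance from the first base point exceeds half the base by almost its distance from the apex.\<close>

lemma half_step:
  fixes e k l d t s' :: real
  assumes k: "99 / 100 \<le> k" "k \<le> 1" and e: "0 \<le> e" "e \<le> 4 * k - 3" and "0 < l"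
    and s': "0 \<le> s'" "s' \<le> 1"
    and d: "e * (l / (2 * k)) * s' \<le> d"
    and t: "l * l / 2 + (2 * k\<^sup>2 - 1) * (d * l) \<le> t * l"
  shows "e * l * ((1 + s') / 2) \<le> t"
proof -
  have "e \<le> 1" using k e by simp
  \<comment> \<open>Expanded, \<open>e * (1 + s') \<le> 1 + e^2 * s'\<close>. The first half of the
    cell is free of loss, and this surplus pays for the second factor \<open>e\<close> on the other
    half, where one comes from \<open>d\<close> and one from the angle.\<close>
  have "0 \<le> (1 - e) * (1 - e * s')"
    using \<open>e \<le> 1\<close> e s' mult_le_one[of e s'] by (intro mult_nonneg_nonneg) auto
  then have "e * ((1 + s') / 2) \<le> 1 / 2 + e * (e * s' / 2)" by (simp add: algebra_simps)
  then have "e * ((1 + s') / 2) * l \<le> (1 / 2 + e * (e * s' / 2)) * l"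
    using \<open>0 < l\<close> by (intro mult_right_mono) auto
  also have "\<dots> = l / 2 + (e * k) * (e * (l / (2 * k)) * s')"
    using k by (simp add: field_simps)
  also have "\<dots> \<le> l / 2 + (2 * k\<^sup>2 - 1) * d"
  proof -
    have "(e * k) * (e * (l / (2 * k)) * s') \<le> (e * k) * d"
      using e k d by (intro mult_left_mono) auto
    moreover have "0 \<le> e * (l / (2 * k)) * s'" using e k s' \<open>0 < l\<close> by simp
    then have "(e * k) * d \<le> (2 * k\<^sup>2 - 1) * d"
      using angle_loss[OF k e(2)] d by (intro mult_right_mono) auto
    ultimately show ?thesis by linarith
  qed
  also have "\<dots> \<le> t"
  proof -
    have "(l / 2 + (2 * k\<^sup>2 - 1) * d) * l \<le> t * l" using t by (simp add: algebra_simps)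
    then show ?thesis using \<open>0 < l\<close> by simp
  qed
  finally show ?thesis by (simp add: mult_ac)
qed

text \<open>In the child containing the end point the induction applies with the same
  \<open>e\<close>, because \<open>kcos\<close> does not decrease; in the other child
  \<open>half_step\<close> carries the estimate across the apex. So a single power of
  \<open>e\<close> suffices at every depth \<open>m\<close>.\<close>

lemma level_point_dist_left_end:
  "\<lbrakk>i \<in> {1..2 ^ n}; s \<in> {0..1}; 0 \<le> e; e \<le> 4 * kcos n i - 3\<rbrakk>
    \<Longrightarrow> e * len n i * s \<le> dist (level_point m n i s) (z n (i - 1))"
proof (induction m arbitrary: n i s)
  case 0
  have "level_point 0 n i s - z n (i - 1) = s *\<^sub>R (z n i - z n (i - 1))"
    using 0 by (simp add: level_point_0 algebra_simps)
  then have "dist (level_point 0 n i s) (z n (i - 1)) = s * len n i"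
    using 0 by (simp add: dist_norm norm_minus_commute)
  moreover have "e \<le> 1" using 0(4) cos_le_one[of "koch_angle z n i"] by linarith
  then have "e * (len n i * s) \<le> 1 * (len n i * s)"
    using 0 by (intro mult_right_mono) auto
  ultimately show ?case by (simp add: mult_ac)
next
  case (Suc m)
  let ?a = "z n (i - 1)" and ?b = "z n i" and ?p = "apex n i" and ?k = "kcos n i"
  have k: "99 / 100 \<le> ?k" "?k \<le> 1" using kcos_ge[OF Suc.prems(1)] by auto
  note i = Suc.prems(1)
  note child = child_index[OF i]
  show ?case
  proof (cases "s \<le> 1 / 2")
    case True
    have le: "?k \<le> kcos (Suc n) (2 * i - 1)" using kcos_child[OF i] by simp
    have "e * len (Suc n) (2 * i - 1) * (2 * s)
        \<le> dist (level_point m (Suc n) (2 * i - 1) (2 * s)) (z (Suc n) (2 * i - 1 - 1))"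
      using Suc.prems True child le by (intro Suc.IH) auto
    then have "e * (len n i / (2 * ?k)) * (2 * s) \<le> dist (level_point (Suc m) n i s) ?a"
      unfolding len_left_child[OF i] unfolding z_left_child[OF i] level_point_left[OF i] .
    moreover have "e * len n i * s * 1 \<le> e * len n i * s * (1 / ?k)"
      using Suc.prems k by (intro mult_left_mono) auto
    ultimately show ?thesis by (simp add: field_simps)
  next
    case False
    define x where "x = level_point m (Suc n) (2 * i) (2 * s - 1)"
    have le: "?k \<le> kcos (Suc n) (2 * i)" using kcos_child[OF i] by simp
    have s': "0 \<le> 2 * s - 1" "2 * s - 1 \<le> 1" using False Suc.prems by auto
    have "e * len (Suc n) (2 * i) * (2 * s - 1) \<le> dist x (z (Suc n) (2 * i - 1))"
      unfolding x_def using Suc.prems s' child le by (intro Suc.IH) auto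
    then have d: "e * (len n i / (2 * ?k)) * (2 * s - 1) \<le> norm (x - ?p)"
      unfolding len_right_child[OF i] unfolding dist_norm[of _ ?p] .
    have "x \<in> koch_cap z (Suc n) (2 * i)"
      unfolding x_def using s' child by (intro level_point_in_cap) auto
    then have "(2 * ?k\<^sup>2 - 1) * (norm (x - ?p) * len n i) \<le> (x - ?p) \<bullet> (?b - ?a)"
      by (rule cone_right_child[OF i])
    moreover have "(?p - ?a) \<bullet> (?b - ?a) = len n i * len n i / 2"
      using isosceles_inner[of ?p ?b ?a] apex_dist[OF i] by (simp add: dist_commute power2_eq_square)
    moreover have "(x - ?a) \<bullet> (?b - ?a) \<le> dist x ?a * len n i"
      using norm_cauchy_schwarz[of "x - ?a" "?b - ?a"] by (simp add: dist_norm norm_minus_commute)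
    moreover have "(x - ?a) \<bullet> (?b - ?a) = (x - ?p) \<bullet> (?b - ?a) + (?p - ?a) \<bullet> (?b - ?a)"
      by (simp flip: inner_add_left)
    ultimately have "len n i * len n i / 2 + (2 * ?k\<^sup>2 - 1) * (norm (x - ?p) * len n i) \<le> dist x ?a * len n i"
      by linarith
    from half_step[OF k Suc.prems(3,4) len_pos[OF i] s' d this]
    show ?thesis unfolding level_point_right x_def by simp
  qed
qed

lemma level_point_dist_right_end:
  "\<lbrakk>i \<in> {1..2 ^ n}; s \<in> {0..1}; 0 \<le> e; e \<le> 4 * kcos n i - 3\<rbrakk>
    \<Longrightarrow> e * len n i * (1 - s) \<le> dist (level_point m n i s) (z n i)"
proof (induction m arbitrary: n i s)
  case 0
  have "level_point 0 n i s - z n i = (1 - s) *\<^sub>R (z n (i - 1) - z n i)"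
    using 0 by (simp add: level_point_0 algebra_simps)
  then have "dist (level_point 0 n i s) (z n i) = (1 - s) * len n i"
    using 0 by (simp add: dist_norm)
  moreover have "e \<le> 1" using 0(4) cos_le_one[of "koch_angle z n i"] by linarith
  then have "e * (len n i * (1 - s)) \<le> 1 * (len n i * (1 - s))"
    using 0 by (intro mult_right_mono) auto
  ultimately show ?case by (simp add: mult_ac)
next
  case (Suc m)
  let ?a = "z n (i - 1)" and ?b = "z n i" and ?p = "apex n i" and ?k = "kcos n i"
  have k: "99 / 100 \<le> ?k" "?k \<le> 1" using kcos_ge[OF Suc.prems(1)] by auto
  note i = Suc.prems(1)
  note child = child_index[OF i]
  show ?case
  proof (cases "1 / 2 \<le> s")
    case True
    have le: "?k \<le> kcos (Suc n) (2 * i)" using kcos_child[OF i] by simp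
    have z': "z (Suc n) (2 * i) = ?b" using z_double i by simp
    have "e * len (Suc n) (2 * i) * (1 - (2 * s - 1))
        \<le> dist (level_point m (Suc n) (2 * i) (2 * s - 1)) (z (Suc n) (2 * i))"
      using Suc.prems True child le by (intro Suc.IH) auto
    then have "e * (len n i / (2 * ?k)) * (1 - (2 * s - 1)) \<le> dist (level_point (Suc m) n i s) ?b"
      unfolding len_right_child[OF i] unfolding z' level_point_right .
    moreover have "e * len n i * (1 - s) * 1 \<le> e * len n i * (1 - s) * (1 / ?k)"
      using Suc.prems k by (intro mult_left_mono) auto
    moreover have "e * (len n i / (2 * ?k)) * (1 - (2 * s - 1)) = e * len n i * (1 - s) * (1 / ?k)"
      using k by (simp add: field_simps)
    ultimately show ?thesis by linarith
  next
    case False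
    define x where "x = level_point m (Suc n) (2 * i - 1) (2 * s)"
    have le: "?k \<le> kcos (Suc n) (2 * i - 1)" using kcos_child[OF i] by simp
    have s': "0 \<le> 1 - 2 * s" "1 - 2 * s \<le> 1" using False Suc.prems by auto
    have "e * len (Suc n) (2 * i - 1) * (1 - 2 * s) \<le> dist x (z (Suc n) (2 * i - 1))"
      unfolding x_def using Suc.prems s' child le by (intro Suc.IH) auto
    then have d: "e * (len n i / (2 * ?k)) * (1 - 2 * s) \<le> norm (x - ?p)"
      unfolding len_left_child[OF i] unfolding dist_norm[of _ ?p] .
    have "x \<in> koch_cap z (Suc n) (2 * i - 1)"
      unfolding x_def using s' child by (intro level_point_in_cap) auto
    then have "(2 * ?k\<^sup>2 - 1) * (norm (x - ?p) * len n i) \<le> (x - ?p) \<bullet> (?a - ?b)"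
      by (rule cone_left_child[OF i])
    moreover have "(?p - ?b) \<bullet> (?a - ?b) = len n i * len n i / 2"
      using isosceles_inner[of ?p ?a ?b] apex_dist[OF i] by (simp add: power2_eq_square)
    moreover have "(x - ?b) \<bullet> (?a - ?b) \<le> dist x ?b * len n i"
      using norm_cauchy_schwarz[of "x - ?b" "?a - ?b"] by (simp add: dist_norm)
    moreover have "(x - ?b) \<bullet> (?a - ?b) = (x - ?p) \<bullet> (?a - ?b) + (?p - ?b) \<bullet> (?a - ?b)"
      by (simp flip: inner_add_left)
    ultimately have "len n i * len n i / 2 + (2 * ?k\<^sup>2 - 1) * (norm (x - ?p) * len n i) \<le> dist x ?b * len n i"
      by linarith
    note half_step[OF k Suc.prems(3,4) len_pos[OF i] s' d this]
    moreover have "(1 + (1 - 2 * s)) / 2 = 1 - s" by (simp add: field_simps)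
    ultimately show ?thesis unfolding level_point_left[OF i] x_def by (simp only:)
  qed
qed

text \<open>Two points of one child inherit the estimate by induction. For points separated by the
  apex, the end point estimates cost one \<open>e\<close> and the cones at the apex another, and the
  recursion stops there; hence \<open>e^2\<close> for every \<open>m\<close>.\<close>

lemma level_point_expanding:
  "\<lbrakk>i \<in> {1..2 ^ n}; 0 \<le> s; s \<le> t; t \<le> 1; 0 \<le> e; e \<le> 4 * kcos n i - 3\<rbrakk>
    \<Longrightarrow> e\<^sup>2 * len n i * (t - s) \<le> dist (level_point m n i s) (level_point m n i t)"
proof (induction m arbitrary: n i s t)
  case 0
  have "level_point 0 n i s - level_point 0 n i t = (t - s) *\<^sub>R (z n (i - 1) - z n i)"
    using 0 by (simp add: level_point_0 algebra_simps)
  then have "dist (level_point 0 n i s) (level_point 0 n i t) = (t - s) * len n i"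
    using 0 by (simp add: dist_norm)
  moreover have "e \<le> 1" using 0(6) cos_le_one[of "koch_angle z n i"] by linarith
  then have "e\<^sup>2 * (len n i * (t - s)) \<le> 1 * (len n i * (t - s))"
    using 0 by (intro mult_right_mono) (auto simp: power_le_one)
  ultimately show ?case by (simp add: mult_ac)
next
  case (Suc m)
  let ?a = "z n (i - 1)" and ?b = "z n i" and ?p = "apex n i" and ?k = "kcos n i"
  have k: "99 / 100 \<le> ?k" "?k \<le> 1" using kcos_ge[OF Suc.prems(1)] by auto
  note i = Suc.prems(1)
  note child = child_index[OF i]
  have le: "?k \<le> kcos (Suc n) (2 * i - 1)" "?k \<le> kcos (Suc n) (2 * i)"
    using kcos_child[OF i] by simp_all
  \<comment> \<open>Relative positions double, while a child is at least half as long as its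
    parent.\<close>
  have scale: "e\<^sup>2 * len n i * (t - s) \<le> e\<^sup>2 * (len n i / (2 * ?k)) * (2 * t - 2 * s)"
  proof -
    have "e\<^sup>2 * len n i * (t - s) * 1 \<le> e\<^sup>2 * len n i * (t - s) * (1 / ?k)"
      using Suc.prems k by (intro mult_left_mono) auto
    then show ?thesis using k by (simp add: field_simps)
  qed
  consider "t \<le> 1 / 2" | "1 / 2 \<le> s" | "s \<le> 1 / 2" "1 / 2 \<le> t" by linarith
  then show ?case
  proof cases
    case 1
    have "e\<^sup>2 * len (Suc n) (2 * i - 1) * (2 * t - 2 * s)
        \<le> dist (level_point m (Suc n) (2 * i - 1) (2 * s)) (level_point m (Suc n) (2 * i - 1) (2 * t))"
      using Suc.prems 1 child le by (intro Suc.IH) auto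
    then show ?thesis
      unfolding level_point_left[OF i] len_left_child[OF i] using scale by linarith
  next
    case 2
    have "e\<^sup>2 * len (Suc n) (2 * i) * ((2 * t - 1) - (2 * s - 1))
        \<le> dist (level_point m (Suc n) (2 * i) (2 * s - 1)) (level_point m (Suc n) (2 * i) (2 * t - 1))"
      using Suc.prems 2 child le by (intro Suc.IH) auto
    then show ?thesis
      unfolding level_point_right len_right_child[OF i] using scale by simp
  next
    case 3
    define x where "x = level_point m (Suc n) (2 * i - 1) (2 * s)"
    define y where "y = level_point m (Suc n) (2 * i) (2 * t - 1)"
    have "e * len (Suc n) (2 * i - 1) * (1 - 2 * s) \<le> dist x (z (Suc n) (2 * i - 1))"
      unfolding x_def using Suc.prems 3 child le by (intro level_point_dist_right_end) auto
    then have x: "e * (len n i / (2 * ?k)) * (1 - 2 * s) \<le> norm (x - ?p)"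
      unfolding len_left_child[OF i] unfolding dist_norm[of _ ?p] .
    have "e * len (Suc n) (2 * i) * (2 * t - 1) \<le> dist y (z (Suc n) (2 * i - 1))"
      unfolding y_def using Suc.prems 3 child le by (intro level_point_dist_left_end) auto
    then have y: "e * (len n i / (2 * ?k)) * (2 * t - 1) \<le> norm (y - ?p)"
      unfolding len_right_child[OF i] unfolding dist_norm[of _ ?p] .
    have "x \<in> koch_cap z (Suc n) (2 * i - 1)" "y \<in> koch_cap z (Suc n) (2 * i)"
      unfolding x_def y_def using 3 Suc.prems child by (intro level_point_in_cap; auto)+
    from cone_left_child[OF i this(1)] cone_right_child[OF i this(2)]
    have "(2 * ?k\<^sup>2 - 1) * ((norm (x - ?p) + norm (y - ?p)) * len n i)
        \<le> (x - ?p) \<bullet> (?a - ?b) + (y - ?p) \<bullet> (?b - ?a)"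
      by (simp add: algebra_simps)
    \<comment> \<open>The two cones open towards opposite ends of the base, so the inner products
      add up instead of cancelling.\<close>
    also have "\<dots> = (x - y) \<bullet> (?a - ?b)"
      by (simp add: inner_diff algebra_simps)
    also have "\<dots> \<le> dist x y * len n i"
      using norm_cauchy_schwarz[of "x - y" "?a - ?b"] by (simp add: dist_norm)
    finally have "(2 * ?k\<^sup>2 - 1) * (norm (x - ?p) + norm (y - ?p)) * len n i \<le> dist x y * len n i"
      by (simp add: mult.assoc)
    then have xy: "(2 * ?k\<^sup>2 - 1) * (norm (x - ?p) + norm (y - ?p)) \<le> dist x y"
      using len_pos[OF i] by simp
    have "e\<^sup>2 * len n i * (t - s)
        = (e * ?k) * (e * (len n i / (2 * ?k)) * (1 - 2 * s) + e * (len n i / (2 * ?k)) * (2 * t - 1))"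
      using k by (simp add: power2_eq_square field_simps)
    also have "\<dots> \<le> (e * ?k) * (norm (x - ?p) + norm (y - ?p))"
      using x y k Suc.prems by (intro mult_left_mono add_mono) auto
    also have "\<dots> \<le> (2 * ?k\<^sup>2 - 1) * (norm (x - ?p) + norm (y - ?p))"
      using angle_loss[OF k] Suc.prems by (intro mult_right_mono) auto
    finally have "e\<^sup>2 * len n i * (t - s) \<le> dist x y" using xy by linarith
    moreover have "level_point (Suc m) n i s = x" "level_point (Suc m) n i t = y"
      using level_point_left[OF i, of m s] level_point_right[of m n i t] by (simp_all only: x_def y_def)
    ultimately show ?thesis by simp
  qed
qed

section \<open>The limit map: convergence, expansion, injectivity, continuity\<close>

text \<open>From level \<open>n\<close> on, all approximants at a given parameter stay in one cap of
  level \<open>n\<close>, and these caps shrink.\<close>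

lemma koch_approx_tendsto:
  assumes "0 \<le> r" "r \<le> 1"
  shows "(\<lambda>n. koch_approx z n (point r)) \<longlonglongrightarrow> param r"
proof -
  have "Cauchy (\<lambda>n. koch_approx z n (point r))"
  proof (rule metric_CauchyI)
    fix e :: real assume "0 < e"
    have "(\<lambda>n. base * (2 / 3) ^ n) \<longlonglongrightarrow> base * 0"
      by (intro tendsto_mult tendsto_const LIMSEQ_power_zero) auto
    then have "\<forall>\<^sub>F n in sequentially. base * (2 / 3) ^ n < e"
      using \<open>0 < e\<close> by (intro order_tendstoD(2)) auto
    then obtain n where n: "base * (2 / 3) ^ n < e" by (auto dest: eventually_happens)
    obtain i s where i: "i \<in> {1..2 ^ n}" "s \<in> {0..1}" "r = (real i - 1 + s) / 2 ^ n"
      using dyadic_cell[OF assms] by metis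
    have cap: "koch_approx z k (point r) \<in> koch_cap z n i" if "n \<le> k" for k
      using level_point_in_cap[OF i(1,2), of "k - n"] that by (simp add: level_point_def i(3))
    show "\<exists>M. \<forall>m\<ge>M. \<forall>n\<ge>M. dist (koch_approx z m (point r)) (koch_approx z n (point r)) < e"
      using dist_cap_le[OF i(1) cap cap] len_le[OF i(1)] n by (meson order.strict_trans1 order_trans)
  qed
  then show ?thesis
    unfolding koch_param_def by (simp add: Cauchy_convergent convergent_LIMSEQ_iff[symmetric])
qed

lemma cell_bounds:
  fixes i :: nat
  assumes "i \<in> {1..2 ^ n}" "s \<in> {0..1}"
  shows "0 \<le> (real i - 1 + s) / 2 ^ n" "(real i - 1 + s) / 2 ^ n \<le> 1"
proof -
  have "real i \<le> 2 ^ n" "1 \<le> real i" using assms(1) by auto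
  then have "0 \<le> real i - 1 + s" "real i - 1 + s \<le> 2 ^ n"
    using assms(2) unfolding atLeastAtMost_iff by linarith+
  then show "0 \<le> (real i - 1 + s) / 2 ^ n" "(real i - 1 + s) / 2 ^ n \<le> 1"
    by (simp_all add: divide_le_eq)
qed

lemma level_point_tendsto:
  assumes "i \<in> {1..2 ^ n}" "s \<in> {0..1}"
  shows "(\<lambda>m. level_point m n i s) \<longlonglongrightarrow> param ((real i - 1 + s) / 2 ^ n)"
  using LIMSEQ_ignore_initial_segment[OF koch_approx_tendsto[OF cell_bounds[OF assms]], of n]
  unfolding level_point_def add.commute[of n] .

lemma param_in_cap:
  assumes "i \<in> {1..2 ^ n}" "s \<in> {0..1}"
  shows "param ((real i - 1 + s) / 2 ^ n) \<in> koch_cap z n i"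
  by (rule Lim_in_closed_set[OF cap_closed _ _ level_point_tendsto[OF assms]])
    (simp_all add: level_point_in_cap[OF assms])

lemma param_expanding:
  assumes i: "i \<in> {1..2 ^ n}" and s: "s \<in> {0..1}" "t \<in> {0..1}" and e: "0 \<le> e" "e \<le> 4 * kcos n i - 3"
  shows "e\<^sup>2 * len n i * \<bar>t - s\<bar>
    \<le> dist (param ((real i - 1 + s) / 2 ^ n)) (param ((real i - 1 + t) / 2 ^ n))"
proof -
  have *: "e\<^sup>2 * len n i * (t - s)
    \<le> dist (param ((real i - 1 + s) / 2 ^ n)) (param ((real i - 1 + t) / 2 ^ n))"
    if "s \<in> {0..1}" "t \<in> {0..1}" "s \<le> t" for s t
  proof (rule tendsto_lowerbound)
    show "(\<lambda>m. dist (level_point m n i s) (level_point m n i t))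
      \<longlonglongrightarrow> dist (param ((real i - 1 + s) / 2 ^ n)) (param ((real i - 1 + t) / 2 ^ n))"
      using that i by (intro tendsto_dist level_point_tendsto) auto
    show "\<forall>\<^sub>F m in sequentially. e\<^sup>2 * len n i * (t - s) \<le> dist (level_point m n i s) (level_point m n i t)"
      using that i e by (intro always_eventually allI level_point_expanding) auto
  qed simp
  show ?thesis
    using *[of s t] *[of t s] s by (cases "s \<le> t") (auto simp: dist_commute)
qed

lemma inj_on_param: "inj_on param {0..1}"
proof (rule inj_onI)
  fix r r' assume r: "r \<in> {0..1}" "r' \<in> {0..1}" "param r = param r'"
  \<comment> \<open>\<open>24 / 25\<close> is \<open>4 * (99 / 100) - 3\<close>, so
    \<open>kcos_base\<close> admits it as \<open>e\<close>.\<close>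
  have "(24 / 25)\<^sup>2 * len 0 1 * \<bar>r' - r\<bar> \<le> dist (param r) (param r')"
    using param_expanding[of 1 0 r r' "24 / 25"] kcos_base r by simp
  then show "r = r'" using r base_pos by (simp add: mult_le_0_iff)
qed

text \<open>Parameters less than \<open>1 / 2 ^ n\<close> apart lie in one cell of level
  \<open>n\<close> or in adjacent cells, whose caps share a vertex.\<close>

lemma param_continuous: "continuous_on {0..1} param"
  unfolding continuous_on_iff
proof (intro ballI allI impI)
  fix r e :: real assume r: "r \<in> {0..1}" and "0 < e"
  have "(\<lambda>n. base * (2 / 3) ^ n) \<longlonglongrightarrow> base * 0"
    by (intro tendsto_mult tendsto_const LIMSEQ_power_zero) auto
  then have "\<forall>\<^sub>F n in sequentially. base * (2 / 3) ^ n < e / 2"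
    using \<open>0 < e\<close> by (intro order_tendstoD(2)) auto
  then obtain n where n: "base * (2 / 3) ^ n < e / 2" by (auto dest: eventually_happens)
  have near: "dist (param x) (param y) < e"
    if x: "x \<in> {0..1}" and y: "y \<in> {0..1}" and xy: "x \<le> y" "y < x + 1 / 2 ^ n" for x y
  proof -
    obtain i s where i: "i \<in> {1..2 ^ n}" "s \<in> {0..1}" "x = (real i - 1 + s) / 2 ^ n"
      using dyadic_cell[of x] x by (metis atLeastAtMost_iff)
    \<comment> \<open>Position of \<open>y\<close> relative to the cell of \<open>x\<close>: up to 1
      it lies in that cell, beyond 1 in the next.\<close>
    let ?t = "y * 2 ^ n - (real i - 1)"
    have yt: "y = (real i - 1 + ?t) / 2 ^ n" by simp
    have t: "0 \<le> ?t" "?t < 2"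
      using i(2) xy by (auto simp: i(3) field_simps)
    show ?thesis
    proof (cases "?t \<le> 1")
      case True
      then have "param y \<in> koch_cap z n i"
        using t i(1) by (subst yt, intro param_in_cap) auto
      moreover have "param x \<in> koch_cap z n i" using param_in_cap[OF i(1,2)] i(3) by simp
      ultimately show ?thesis
        using dist_cap_le[OF i(1)] len_le[OF i(1)] n \<open>0 < e\<close> by fastforce
    next
      case False
      have "real i < y * 2 ^ n" using False by simp
      also have "\<dots> \<le> 2 ^ n" using y by simp
      finally have "i < 2 ^ n" by (simp add: of_nat_less_iff[symmetric] del: of_nat_less_iff)
      then have j: "Suc i \<in> {1..2 ^ n}" by simp
      have "y = (real (Suc i) - 1 + (?t - 1)) / 2 ^ n" by simp
      then have "param y \<in> koch_cap z n (Suc i)"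
        using param_in_cap[OF j, of "?t - 1"] False t by auto
      moreover have "z n i \<in> koch_cap z n (Suc i)" using vertices_in_cap(1)[of n "Suc i"] by simp
      ultimately have "dist (z n i) (param y) < e / 2"
        using dist_cap_le[OF j, of "z n i" "param y"] len_le[OF j] n by linarith
      moreover have "param x \<in> koch_cap z n i" using param_in_cap[OF i(1,2)] i(3) by simp
      then have "dist (param x) (z n i) < e / 2"
        using dist_cap_le[OF i(1) _ vertices_in_cap(2)] len_le[OF i(1)] n by fastforce
      ultimately show ?thesis using dist_triangle[of "param x" "param y" "z n i"] by linarith
    qed
  qed
  show "\<exists>d>0. \<forall>x'\<in>{0..1}. dist x' r < d \<longrightarrow> dist (param x') (param r) < e"
  proof (intro exI[of _ "1 / 2 ^ n"] conjI ballI impI)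
    fix x' assume x': "x' \<in> {0..1}" "dist x' r < 1 / 2 ^ n"
    show "dist (param x') (param r) < e"
      using near[of x' r] near[of r x'] x' r by (cases "x' \<le> r") (auto simp: dist_commute dist_real_def)
  qed simp
qed

section \<open>Hausdorff measure of the image\<close>

lemma koch_segment_eq: "koch_segment z 0 1 = point ` {0..1}"
proof -
  have "point r = (1 - r) *\<^sub>R z 0 0 + r *\<^sub>R z 0 1" for r by (simp add: algebra_simps)
  then show ?thesis by (auto simp: koch_segment_def closed_segment_def)
qed

lemma dist_point: "dist (point r) (point r') = \<bar>r - r'\<bar> * base"
  by (simp add: dist_norm norm_minus_commute flip: scaleR_diff_left)

lemma koch_param_continuous: "continuous_on (koch_segment z 0 1) (koch_param z)"
proof -
  define w where "w = z 0 1 - z 0 0"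
  \<comment> \<open>\<open>c\<close> recovers the parameter of a point of the segment by orthogonal
    projection.\<close>
  define c where "c t = ((t - z 0 0) \<bullet> w) / (w \<bullet> w)" for t
  have "w \<noteq> 0" using base_pos by (auto simp: w_def)
  have c: "c (point r) = r" for r
    unfolding c_def w_def[symmetric] using \<open>w \<noteq> 0\<close> by simp
  have "continuous_on (koch_segment z 0 1) c"
    unfolding c_def using \<open>w \<noteq> 0\<close> by (intro continuous_intros) auto
  moreover have "c ` koch_segment z 0 1 \<subseteq> {0..1}" unfolding koch_segment_eq using c by auto
  ultimately have "continuous_on (koch_segment z 0 1) (\<lambda>t. param (c t))"
    by (intro continuous_on_compose2[OF param_continuous])
  then show ?thesis
  proof (rule continuous_on_eq)
    fix t assume "t \<in> koch_segment z 0 1"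
    then obtain r where "t = point r" unfolding koch_segment_eq by blast
    then show "param (c t) = koch_param z t" by (simp only: c)
  qed
qed

lemma segment_cell:
  assumes "t \<in> koch_segment z 0 1"
  obtains i s where "i \<in> {1..2 ^ n}" "s \<in> {0..1}" "t = point ((real i - 1 + s) / 2 ^ n)"
    "koch_param z t \<in> koch_cap z n i"
proof -
  obtain r where r: "0 \<le> r" "r \<le> 1" "t = point r" using assms unfolding koch_segment_eq by auto
  obtain i s where i: "i \<in> {1..2 ^ n}" "s \<in> {0..1}" "r = (real i - 1 + s) / 2 ^ n"
    using dyadic_cell[OF r(1,2)] by metis
  show ?thesis using i r(3) param_in_cap[OF i(1,2)] by (intro that[of i s]) auto
qed

lemma koch_param_in_full_set:
  assumes "t \<in> koch_segment z 0 1"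
  shows "koch_param z t \<in> koch_full_set z"
  unfolding koch_full_set_def
proof (rule INT_I)
  fix n
  show "koch_param z t \<in> (\<Union>i\<in>{1..2^n}. koch_cap z n i)"
    using segment_cell[OF assms, of n] by blast
qed

lemma inj_on_koch_param: "inj_on (koch_param z) (koch_segment z 0 1)"
  unfolding koch_segment_eq by (rule inj_on_imageI) (simp only: comp_def inj_on_param)

lemma countable_exceptional: "countable (koch_exceptional_set z)"
  unfolding koch_exceptional_set_def by auto

section \<open>Disjointness of the caps away from the vertices\<close>

text \<open>The cones of the two children open in opposite directions along the base, so their only
  common point is the apex.\<close>

lemma sibling_caps_Int:
  assumes i: "i \<in> {1..2 ^ n}"
    and x: "x \<in> koch_cap z (Suc n) (2 * i - 1)" "x \<in> koch_cap z (Suc n) (2 * i)"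
  shows "x = apex n i"
proof -
  let ?k = "kcos n i" and ?p = "apex n i"
  have "(2 * ?k\<^sup>2 - 1) * (norm (x - ?p) * len n i) + (2 * ?k\<^sup>2 - 1) * (norm (x - ?p) * len n i)
      \<le> (x - ?p) \<bullet> (z n (i - 1) - z n i) + (x - ?p) \<bullet> (z n i - z n (i - 1))"
    by (intro add_mono cone_left_child cone_right_child i x)
  also have "\<dots> = 0" by (simp flip: inner_add_right)
  finally have "(2 * ?k\<^sup>2 - 1) * (norm (x - ?p) * len n i) \<le> 0" by linarith
  moreover have "(99 / 100)\<^sup>2 \<le> ?k\<^sup>2" using kcos_ge[OF i] by (intro power_mono) auto
  then have "0 < 2 * ?k\<^sup>2 - 1" by (simp add: power2_eq_square)
  ultimately have "norm (x - ?p) * len n i \<le> 0" by (simp add: mult_le_0_iff)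
  then show ?thesis using len_pos[OF i] by (simp add: mult_le_0_iff)
qed

text \<open>Two caps through \<open>x\<close> have the same parent by induction, and siblings share
  only the apex, which is an exceptional point.\<close>

lemma cap_unique:
  assumes "x \<notin> koch_exceptional_set z"
  shows "i \<in> {1..2 ^ n} \<Longrightarrow> j \<in> {1..2 ^ n} \<Longrightarrow> x \<in> koch_cap z n i \<Longrightarrow> x \<in> koch_cap z n j \<Longrightarrow> i = j"
proof (induction n arbitrary: i j)
  case (Suc n)
  obtain i' where i': "i' \<in> {1..2 ^ n}" "i = 2 * i' - 1 \<or> i = 2 * i'"
    using parent_index[OF Suc.prems(1)] .
  obtain j' where j': "j' \<in> {1..2 ^ n}" "j = 2 * j' - 1 \<or> j = 2 * j'"
    using parent_index[OF Suc.prems(2)] .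
  have "x \<in> koch_cap z n i'" "x \<in> koch_cap z n j'"
    using cap_child(1)[OF i'(1), of i] cap_child(1)[OF j'(1), of j] i' j' Suc.prems by auto
  then have eq: "i' = j'" using Suc.IH i'(1) j'(1) by blast
  have "apex n i' \<in> koch_exceptional_set z"
    using i'(1) unfolding koch_exceptional_set_def koch_apex_def by blast
  then have "\<not> (x \<in> koch_cap z (Suc n) (2 * i' - 1) \<and> x \<in> koch_cap z (Suc n) (2 * i'))"
    using sibling_caps_Int[OF i'(1)] assms by auto
  then show ?case using i' j' eq Suc.prems by auto
qed auto

lemma koch_index_eq:
  assumes "x \<notin> koch_exceptional_set z" "i \<in> {1..2 ^ n}" "x \<in> koch_cap z n i"
  shows "koch_index z n x = i"
proof -
  have "{i \<in> {1..2 ^ n}. x \<in> koch_cap z n i} = {i}"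
    using cap_unique[OF assms(1)] assms(2,3) by blast
  then show ?thesis by (simp add: koch_index_def)
qed

section \<open>Finite and infinite products of the stretching factors\<close>

definition point_cos :: "nat \<Rightarrow> real^2 \<Rightarrow> real" where
  "point_cos n x = kcos n (koch_index z n x)"

definition stretch :: "nat \<Rightarrow> real^2 \<Rightarrow> real" where
  "stretch n x = (\<Prod>k<n. inverse (point_cos k x))"

text \<open>Coincides with \<open>koch_Pi\<close> on \<open>regular_set\<close>, see
  \<open>koch_Pi_eq\<close>. Written as a supremum of Borel functions, it is Borel on the whole
  plane.\<close>

definition total_stretch :: "real^2 \<Rightarrow> ennreal" where
  "total_stretch x = (SUP n. ennreal (stretch n x))"

text \<open>Each of its points lies in exactly one cap of every level. Either choice of the Koch
  type set contains it and adds at most countably many points.\<close>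

definition regular_set :: "(real^2) set" where
  "regular_set = koch_full_set z - koch_exceptional_set z"

lemma regular_index:
  assumes "x \<in> regular_set"
  shows "koch_index z n x \<in> {1..2 ^ n}" "x \<in> koch_cap z n (koch_index z n x)"
proof -
  have "x \<in> (\<Union>i\<in>{1..2^n}. koch_cap z n i)"
    using assms unfolding regular_set_def koch_full_set_def by blast
  then obtain i where "i \<in> {1..2 ^ n}" "x \<in> koch_cap z n i" by blast
  then show "koch_index z n x \<in> {1..2 ^ n}" "x \<in> koch_cap z n (koch_index z n x)"
    using koch_index_eq[of x i n] assms by (auto simp: regular_set_def)
qed

lemma regular_index_child:
  assumes "x \<in> regular_set"
  shows "koch_index z (Suc n) x = 2 * koch_index z n x - 1 \<or> koch_index z (Suc n) x = 2 * koch_index z n x"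
proof -
  obtain j where j: "j \<in> {1..2 ^ n}" "koch_index z (Suc n) x = 2 * j - 1 \<or> koch_index z (Suc n) x = 2 * j"
    using parent_index[OF regular_index(1)[OF assms, of "Suc n"]] .
  then have "x \<in> koch_cap z n j"
    using cap_child(1)[OF j(1), of "koch_index z (Suc n) x"] regular_index(2)[OF assms, of "Suc n"] by auto
  then have "koch_index z n x = j"
    using j(1) assms by (intro koch_index_eq) (auto simp: regular_set_def)
  then show ?thesis using j(2) by simp
qed

lemma point_cos_bounds:
  assumes "x \<in> regular_set"
  shows "99 / 100 \<le> point_cos n x" "point_cos n x \<le> 1" "point_cos n x \<le> point_cos (Suc n) x"
proof -
  note i = regular_index(1)[OF assms, of n]
  show "99 / 100 \<le> point_cos n x" using kcos_ge[OF i] by (simp add: point_cos_def)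
  show "point_cos n x \<le> 1" by (simp add: point_cos_def)
  show "point_cos n x \<le> point_cos (Suc n) x"
    unfolding point_cos_def using regular_index_child[OF assms, of n] by (intro kcos_child i) auto
qed

lemma incseq_point_cos: "x \<in> regular_set \<Longrightarrow> incseq (\<lambda>n. point_cos n x)"
  by (intro incseq_SucI point_cos_bounds)

lemma stretch_ge_1:
  assumes "x \<in> regular_set"
  shows "1 \<le> stretch n x"
  unfolding stretch_def
proof (rule prod_ge_1)
  fix k
  show "1 \<le> inverse (point_cos k x)"
    using point_cos_bounds(1,2)[OF assms, of k] by (intro one_le_inverse) auto
qed

lemma incseq_stretch:
  assumes "x \<in> regular_set"
  shows "incseq (\<lambda>n. stretch n x)"
proof (rule incseq_SucI)
  fix n
  have "1 \<le> inverse (point_cos n x)"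
    using point_cos_bounds(1,2)[OF assms, of n] by (intro one_le_inverse) auto
  then have "stretch n x * 1 \<le> stretch n x * inverse (point_cos n x)"
    using stretch_ge_1[OF assms, of n] by (intro mult_left_mono) auto
  then show "stretch n x \<le> stretch (Suc n) x" by (simp add: stretch_def)
qed

lemma total_stretch_ge_1: "x \<in> regular_set \<Longrightarrow> 1 \<le> total_stretch x"
  unfolding total_stretch_def using stretch_ge_1[of x 0] by (intro SUP_upper2[of 0]) auto

text \<open>The parameter cell is halved at each level, while the segment is divided by
  \<open>2 * kcos n i\<close>; the quotient gains one factor 1/cos.\<close>

lemma len_eq_stretch:
  assumes "x \<in> regular_set"
  shows "len n (koch_index z n x) * 2 ^ n = base * stretch n x"
proof (induction n)
  case 0
  then show ?case using regular_index(1)[OF assms, of 0] by (simp add: stretch_def)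
next
  case (Suc n)
  let ?i = "koch_index z n x"
  have i: "?i \<in> {1..2 ^ n}" by (rule regular_index(1)[OF assms])
  have "len (Suc n) (koch_index z (Suc n) x) = len n ?i / (2 * kcos n ?i)"
    using regular_index_child[OF assms, of n] len_left_child[OF i] len_right_child[OF i] by metis
  then have "len (Suc n) (koch_index z (Suc n) x) * 2 ^ Suc n = (len n ?i * 2 ^ n) / kcos n ?i"
    by (simp add: field_simps)
  then show ?case unfolding Suc.IH by (simp add: stretch_def point_cos_def divide_inverse)
qed

lemma koch_Pi_eq:
  assumes "x \<in> regular_set"
  shows "koch_Pi z x = total_stretch x"
proof -
  define f where "f n = ennreal (inverse (point_cos n x))" for n
  have pos: "0 \<le> inverse (point_cos n x)" for n using point_cos_bounds(1)[OF assms, of n] by simp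
  have f: "(\<Prod>k<n. f k) = ennreal (stretch n x)" for n
    unfolding f_def stretch_def using pos by (intro prod_ennreal) auto
  have nz: "f n \<noteq> 0" for n
    using point_cos_bounds(1)[OF assms, of n] by (simp add: f_def)
  have "(\<lambda>n. ennreal (stretch n x)) \<longlonglongrightarrow> total_stretch x"
    unfolding total_stretch_def using incseq_stretch[OF assms]
    by (intro LIMSEQ_SUP) (auto simp: incseq_def intro: ennreal_leI)
  then have lim: "(\<lambda>n. \<Prod>i\<le>n. f i) \<longlonglongrightarrow> total_stretch x"
    unfolding lessThan_Suc_atMost[symmetric] f by (rule LIMSEQ_Suc)
  have "f has_prod p \<longleftrightarrow> p = total_stretch x" for p
  proof
    assume "f has_prod p"
    then have "raw_has_prod f 0 p" using nz by (auto simp: has_prod_def)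
    then show "p = total_stretch x"
      using lim by (auto simp: raw_has_prod_def intro: LIMSEQ_unique)
  next
    assume "p = total_stretch x"
    then show "f has_prod p"
      using lim total_stretch_ge_1[OF assms] by (auto simp: has_prod_def raw_has_prod_def)
  qed
  then have "prodinf f = total_stretch x" by (simp add: prodinf_def)
  then show ?thesis by (simp add: koch_Pi_def f_def[abs_def] point_cos_def)
qed

lemma cap_borel [measurable]: "koch_cap z n i \<in> sets borel"
  using cap_closed by simp

lemma point_cos_borel [measurable]: "point_cos n \<in> borel_measurable borel"
proof -
  have "(\<lambda>x. Max {i. i \<in> {1..2 ^ n} \<and> x \<in> koch_cap z n i}) \<in> measurable borel (count_space UNIV)"
    by measurable
  then have [measurable]: "koch_index z n \<in> measurable borel (count_space UNIV)"
    by (simp add: koch_index_def[abs_def])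
  show ?thesis unfolding point_cos_def[abs_def] by measurable
qed

lemma stretch_borel [measurable]: "stretch n \<in> borel_measurable borel"
  unfolding stretch_def[abs_def] by measurable

lemma total_stretch_borel [measurable]: "total_stretch \<in> borel_measurable borel"
  unfolding total_stretch_def[abs_def] by measurable

text \<open>The integrals run over the whole plane, so the parametrisation is extended by 0 outside
  the base segment to a Borel function.\<close>

definition ext_param :: "real^2 \<Rightarrow> real^2" where
  "ext_param t = indicator (koch_segment z 0 1) t *\<^sub>R koch_param z t"

lemma ext_param_eq: "t \<in> koch_segment z 0 1 \<Longrightarrow> ext_param t = koch_param z t"
  by (simp add: ext_param_def)

lemma ext_param_measurable [measurable]: "ext_param \<in> measurable hausdorff1_measure borel"
proof -
  have "koch_segment z 0 1 \<in> sets borel" by (simp add: koch_segment_def)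
  then have "ext_param \<in> borel_measurable borel"
    unfolding ext_param_def[abs_def]
    by (intro borel_measurable_continuous_on_indicator koch_param_continuous)
  then show ?thesis
    using borel_subset_hausdorff1 by (auto simp: measurable_def)
qed

section \<open>Lower bound for the measure of the image\<close>

text \<open>Away from the vertices the cap determines the cell, which gives a converse of
  \<open>param_in_cap\<close>.\<close>

lemma cell_of_cap:
  assumes "t \<in> koch_segment z 0 1" "koch_param z t \<in> regular_set"
    and "i \<in> {1..2 ^ n}" "koch_param z t \<in> koch_cap z n i"
  obtains s where "s \<in> {0..1}" "t = point ((real i - 1 + s) / 2 ^ n)"
proof -
  obtain j s where j: "j \<in> {1..2 ^ n}" "s \<in> {0..1}" "t = point ((real j - 1 + s) / 2 ^ n)"
    "koch_param z t \<in> koch_cap z n j"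
    by (rule segment_cell[OF assms(1)])
  then have "j = i" using cap_unique assms by (auto simp: regular_set_def)
  then show ?thesis using j that by blast
qed

lemma hausdorff1_image_cap_ge:
  assumes X: "X \<subseteq> koch_segment z 0 1" "koch_param z ` X \<subseteq> regular_set \<inter> koch_cap z n i"
    and i: "i \<in> {1..2 ^ n}" and e: "0 < e" "e \<le> 4 * kcos n i - 3"
  shows "ennreal (e\<^sup>2) * (ennreal (len n i * 2 ^ n / base) * hausdorff1 X) \<le> hausdorff1 (koch_param z ` X)"
proof -
  \<comment> \<open>Length of the segment over length of its cell, that is, \<open>stretch n\<close>
    at the regular points of the cap. The factor \<open>e^2\<close> is kept apart because it is
    common to all cells.\<close>
  let ?v = "len n i * 2 ^ n / base"
  have "ennreal (e\<^sup>2 * ?v) * hausdorff1 X \<le> hausdorff1 (koch_param z ` X)"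
  proof (rule hausdorff1_image_ge)
    show "0 < e\<^sup>2 * ?v" using e len_pos[OF i] base_pos by simp
    fix x y assume xy: "x \<in> X" "y \<in> X"
    obtain s where s: "s \<in> {0..1}" "x = point ((real i - 1 + s) / 2 ^ n)"
      using cell_of_cap[of x i n] xy X i by blast
    obtain t where t: "t \<in> {0..1}" "y = point ((real i - 1 + t) / 2 ^ n)"
      using cell_of_cap[of y i n] xy X i by blast
    have "(real i - 1 + s) / 2 ^ n - (real i - 1 + t) / 2 ^ n = (s - t) / 2 ^ n"
      by (simp add: field_simps)
    then have "dist x y = \<bar>t - s\<bar> / 2 ^ n * base"
      unfolding s(2) t(2) dist_point by (simp add: abs_minus_commute)
    then have "e\<^sup>2 * ?v * dist x y = e\<^sup>2 * len n i * \<bar>t - s\<bar>"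
      using base_pos by (simp add: field_simps)
    also have "\<dots> \<le> dist (koch_param z x) (koch_param z y)"
      unfolding s(2) t(2) using i s t e by (intro param_expanding) auto
    finally show "e\<^sup>2 * ?v * dist x y \<le> dist (koch_param z x) (koch_param z y)" .
  qed
  moreover have "ennreal (e\<^sup>2 * ?v) = ennreal (e\<^sup>2) * ennreal ?v" by (intro ennreal_mult) auto
  ultimately show ?thesis by (simp only: mult.assoc)
qed

text \<open>The integrand is constant on the part of \<open>S\<close> in each cell, and cells whose
  angle is too large for \<open>e\<close> are cut off to 0. The caps without vertices are disjoint
  Borel sets, so the estimates on the cells add up inside the image.\<close>

lemma nn_integral_stretch_le:
  assumes S: "S \<in> sets hausdorff1_measure" "S \<subseteq> koch_segment z 0 1" "koch_param z ` S \<subseteq> regular_set"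
    and e: "0 < e"
  shows "ennreal (e\<^sup>2) * (\<integral>\<^sup>+t. (if e \<le> 4 * point_cos n (ext_param t) - 3
      then ennreal (stretch n (ext_param t)) else 0) * indicator S t \<partial>hausdorff1_measure)
    \<le> hausdorff1 (koch_param z ` S)"
proof -
  define v where "v i = (if e \<le> 4 * kcos n i - 3 then ennreal (len n i * 2 ^ n / base) else 0)" for i
  define P where "P i = {t \<in> S. ext_param t \<in> koch_cap z n i}" for i
  let ?I = "{1..(2::nat) ^ n}"
  have P_meas: "P i \<in> sets hausdorff1_measure" for i
  proof -
    have "P i = S \<inter> (ext_param -` koch_cap z n i \<inter> space hausdorff1_measure)" by (auto simp: P_def)
    then show ?thesis using S(1) measurable_sets[OF ext_param_measurable cap_borel] by auto
  qed
  have eq: "(if e \<le> 4 * point_cos n (ext_param t) - 3 then ennreal (stretch n (ext_param t)) else 0)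
      * indicator S t = (\<Sum>i\<in>?I. v i * indicator (P i) t)" for t
  proof (cases "t \<in> S")
    case True
    then have reg: "ext_param t \<in> regular_set" using S ext_param_eq by auto
    let ?i = "koch_index z n (ext_param t)"
    note idx = regular_index[OF reg, of n]
    have "(\<Sum>i\<in>?I. v i * indicator (P i) t) = (\<Sum>i\<in>?I. if i = ?i then v i else 0)"
    proof (rule sum.cong)
      fix i assume "i \<in> ?I"
      then have "t \<in> P i \<longleftrightarrow> i = ?i"
        using True idx koch_index_eq[of "ext_param t" i n] reg by (auto simp: P_def regular_set_def)
      then show "v i * indicator (P i) t = (if i = ?i then v i else 0)" by auto
    qed simp
    also have "\<dots> = v ?i" using idx by (simp add: sum.delta)
    also have "v ?i = (if e \<le> 4 * point_cos n (ext_param t) - 3 then ennreal (stretch n (ext_param t)) else 0)"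
      using len_eq_stretch[OF reg, of n] base_pos by (simp add: v_def point_cos_def)
    finally show ?thesis using True by simp
  qed (auto simp: P_def)
  have "ennreal (e\<^sup>2) * (\<integral>\<^sup>+t. (\<Sum>i\<in>?I. v i * indicator (P i) t) \<partial>hausdorff1_measure)
      = (\<Sum>i\<in>?I. ennreal (e\<^sup>2) * (v i * hausdorff1 (P i)))"
    using P_meas by (subst nn_integral_sum)
      (simp_all add: nn_integral_cmult_indicator emeasure_hausdorff1_measure sum_distrib_left)
  also have "\<dots> \<le> (\<Sum>i\<in>?I. hausdorff1 (koch_param z ` S \<inter> (koch_cap z n i - koch_exceptional_set z)))"
  proof (rule sum_mono)
    fix i assume i: "i \<in> ?I"
    have P: "koch_param z ` P i = koch_param z ` S \<inter> (koch_cap z n i - koch_exceptional_set z)"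
      using S ext_param_eq by (fastforce simp: P_def regular_set_def)
    have "ennreal (e\<^sup>2) * (v i * hausdorff1 (P i)) \<le> hausdorff1 (koch_param z ` P i)"
    proof (cases "e \<le> 4 * kcos n i - 3")
      case True
      have "P i \<subseteq> koch_segment z 0 1" "koch_param z ` P i \<subseteq> regular_set \<inter> koch_cap z n i"
        using S(2,3) ext_param_eq by (fastforce simp: P_def)+
      from hausdorff1_image_cap_ge[OF this i e True] show ?thesis
        unfolding v_def if_P[OF True] .
    qed (simp add: v_def)
    then show "ennreal (e\<^sup>2) * (v i * hausdorff1 (P i))
      \<le> hausdorff1 (koch_param z ` S \<inter> (koch_cap z n i - koch_exceptional_set z))" unfolding P .
  qed
  also have "\<dots> = hausdorff1 (koch_param z ` S \<inter> (\<Union>i\<in>?I. koch_cap z n i - koch_exceptional_set z))"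
  proof (rule hausdorff1_sum_Int)
    show "koch_cap z n i - koch_exceptional_set z \<in> sets hausdorff1_measure" for i
    proof -
      have "koch_exceptional_set z \<in> sets borel" by (rule sets.countable[OF _ countable_exceptional]) simp
      then have "koch_cap z n i - koch_exceptional_set z \<in> sets borel" by (intro sets.Diff cap_borel)
      then show ?thesis using borel_subset_hausdorff1 by blast
    qed
    show "disjoint_family_on (\<lambda>i. koch_cap z n i - koch_exceptional_set z) ?I"
      unfolding disjoint_family_on_def using cap_unique by blast
  qed simp
  also have "\<dots> \<le> hausdorff1 (koch_param z ` S)" by (intro hausdorff1_mono) auto
  finally show ?thesis unfolding eq .
qed

text \<open>If the cosines stayed below a constant smaller than 1, the products would grow
  geometrically, against finiteness. Once a cosine passes the threshold, monotonicity keeps it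
  there, so the cutoff disappears in the supremum.\<close>

lemma SUP_restricted_stretch:
  assumes x: "x \<in> regular_set" "total_stretch x < top" and e: "e < 1"
  shows "(SUP n. (if e \<le> 4 * point_cos n x - 3 then ennreal (stretch n x) else 0)) = total_stretch x"
proof (rule antisym)
  show "(SUP n. (if e \<le> 4 * point_cos n x - 3 then ennreal (stretch n x) else 0)) \<le> total_stretch x"
    unfolding total_stretch_def by (intro SUP_mono) auto
  obtain N where N: "e \<le> 4 * point_cos N x - 3"
  proof (rule ccontr)
    assume no: "\<not> thesis"
    \<comment> \<open>For nonnegative \<open>e\<close> this solves
      \<open>4 * \<kappa> - 3 = e\<close>; the maximum keeps \<kappa> positive for every
      \<open>e < 1\<close>.\<close>
    define \<kappa> where "\<kappa> = (3 + max e 0) / 4"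
    have \<kappa>: "0 < \<kappa>" "\<kappa> < 1" using e by (auto simp: \<kappa>_def)
    have "point_cos n x \<le> \<kappa>" for n
      using no that[of n] by (cases "e \<le> 4 * point_cos n x - 3") (auto simp: \<kappa>_def)
    then have "inverse \<kappa> \<le> inverse (point_cos n x)" for n
      using point_cos_bounds(1)[OF x(1), of n] by (intro le_imp_inverse_le) auto
    then have "(\<Prod>k<n. inverse \<kappa>) \<le> stretch n x" for n
      unfolding stretch_def using \<kappa> by (intro prod_mono) auto
    then have pow: "inverse \<kappa> ^ n \<le> stretch n x" for n by simp
    obtain M where M: "total_stretch x = ennreal M" "0 \<le> M"
      using x(2) by (cases "total_stretch x") auto
    obtain n where "M < inverse \<kappa> ^ n"
      using real_arch_pow[of "inverse \<kappa>" M] \<kappa> by (auto simp: one_less_inverse)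
    then have "M < stretch n x" using pow[of n] by linarith
    moreover have "ennreal (stretch n x) \<le> ennreal M"
      unfolding M(1)[symmetric] total_stretch_def by (intro SUP_upper) auto
    ultimately show False using M(2) by simp
  qed
  show "total_stretch x \<le> (SUP n. (if e \<le> 4 * point_cos n x - 3 then ennreal (stretch n x) else 0))"
    unfolding total_stretch_def
  proof (rule SUP_mono)
    fix n
    have "point_cos N x \<le> point_cos (max n N) x" "stretch n x \<le> stretch (max n N) x"
      using incseq_point_cos[OF x(1)] incseq_stretch[OF x(1)] by (auto simp: incseq_def)
    then have "ennreal (stretch n x) \<le> (if e \<le> 4 * point_cos (max n N) x - 3
        then ennreal (stretch (max n N) x) else 0)"
      using N by (auto intro: ennreal_leI)
    then show "\<exists>m\<in>UNIV. ennreal (stretch n x) \<le> (if e \<le> 4 * point_cos m x - 3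
        then ennreal (stretch m x) else 0)" by blast
  qed
qed

lemma nn_integral_total_stretch_le:
  assumes S: "S \<in> sets hausdorff1_measure" "S \<subseteq> koch_segment z 0 1" "koch_param z ` S \<subseteq> regular_set"
    and fin: "\<And>t. t \<in> S \<Longrightarrow> total_stretch (koch_param z t) < top"
  shows "(\<integral>\<^sup>+t. total_stretch (ext_param t) * indicator S t \<partial>hausdorff1_measure)
    \<le> hausdorff1 (koch_param z ` S)"
proof -
  let ?I = "\<integral>\<^sup>+t. total_stretch (ext_param t) * indicator S t \<partial>hausdorff1_measure"
  have le: "ennreal (e\<^sup>2) * ?I \<le> hausdorff1 (koch_param z ` S)" if e: "0 < e" "e < 1" for e
  proof -
    define g where "g n t = (if e \<le> 4 * point_cos n (ext_param t) - 3
      then ennreal (stretch n (ext_param t)) else 0) * indicator S t" for n t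
    have reg: "ext_param t \<in> regular_set" "total_stretch (ext_param t) < top" if "t \<in> S" for t
    proof -
      have "ext_param t = koch_param z t" using that S(2) by (intro ext_param_eq) blast
      then show "ext_param t \<in> regular_set" "total_stretch (ext_param t) < top"
        using that S(3) fin[OF that] by auto
    qed
    have "?I = (\<integral>\<^sup>+t. (SUP n. g n t) \<partial>hausdorff1_measure)"
    proof (rule nn_integral_cong)
      fix t
      show "total_stretch (ext_param t) * indicator S t = (SUP n. g n t)"
        using SUP_restricted_stretch[OF reg e(2), of t] by (cases "t \<in> S") (auto simp: g_def)
    qed
    also have "\<dots> = (SUP n. \<integral>\<^sup>+t. g n t \<partial>hausdorff1_measure)"
    proof (rule nn_integral_monotone_convergence_SUP)
      \<comment> \<open>The cutoff condition, once satisfied, stays so at later levels, and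
        \<open>stretch\<close> increases.\<close>
      show "incseq g"
      proof (rule incseq_SucI, rule le_funI)
        fix n t
        show "g n t \<le> g (Suc n) t"
        proof (cases "t \<in> S")
          case True
          then show ?thesis
            using point_cos_bounds(3)[OF reg(1), of t n] incseq_SucD[OF incseq_stretch[OF reg(1)], of t n]
            by (auto simp: g_def intro: ennreal_leI)
        qed (simp add: g_def)
      qed
      show "g n \<in> borel_measurable hausdorff1_measure" for n
        unfolding g_def[abs_def] using S(1) by measurable
    qed
    finally have "ennreal (e\<^sup>2) * ?I = (SUP n. ennreal (e\<^sup>2) * (\<integral>\<^sup>+t. g n t \<partial>hausdorff1_measure))"
      by (simp add: SUP_mult_left_ennreal)
    also have "\<dots> \<le> hausdorff1 (koch_param z ` S)"
      unfolding g_def by (intro SUP_least nn_integral_stretch_le S e)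
    finally show ?thesis .
  qed
  show ?thesis
  proof (rule LIMSEQ_le_const2)
    \<comment> \<open>The shift by 2 keeps \<open>?e n\<close> strictly between 0 and 1 already for
      \<open>n = 0\<close>.\<close>
    let ?e = "\<lambda>n. 1 - 1 / real (n + 2)"
    have "(\<lambda>n. ?e n) \<longlonglongrightarrow> 1 - 0"
      using LIMSEQ_ignore_initial_segment[OF lim_1_over_n, of 2] by (intro tendsto_diff tendsto_const) simp
    then have "(\<lambda>n. ennreal ((?e n)\<^sup>2)) \<longlonglongrightarrow> ennreal (1\<^sup>2)"
      by (intro tendsto_ennrealI tendsto_power) simp
    then have "(\<lambda>n. ennreal ((?e n)\<^sup>2) * ?I) \<longlonglongrightarrow> ennreal (1\<^sup>2) * ?I"
      by (intro tendsto_mult_ennreal tendsto_const) auto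
    then show "(\<lambda>n. ennreal ((?e n)\<^sup>2) * ?I) \<longlonglongrightarrow> ?I" by simp
    show "\<exists>N. \<forall>n\<ge>N. ennreal ((?e n)\<^sup>2) * ?I \<le> hausdorff1 (koch_param z ` S)"
      by (intro exI[of _ 0] allI impI le) auto
  qed
qed

section \<open>Upper bound for the measure of the image\<close>

text \<open>The caps of level \<open>n\<close> that meet the image have diameter at most
  \<open>b * base / 2 ^ n\<close>, and their number is at most the diameter of \<open>V\<close> over
  the cell length, plus 2. The surplus vanishes as \<open>n\<close> grows, so the constant is
  exactly \<open>b\<close>. Bounding each pair of points by a common cap would be too coarse, since
  close parameters may share only a large cap.\<close>

lemma hausdorff1_image_le_diameter:
  assumes V: "V \<subseteq> koch_segment z 0 1" "koch_param z ` V \<subseteq> regular_set"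
    and b: "0 < b" "\<And>t. t \<in> V \<Longrightarrow> total_stretch (koch_param z t) \<le> ennreal b"
  shows "hausdorff1 (koch_param z ` V) \<le> ennreal (b * diameter V)"
proof (cases "V = {}")
  case False
  have bdd: "bounded V"
    using V(1) by (rule bounded_subset[rotated]) (simp add: koch_segment_def compact_imp_bounded)
  define d where "d n = b * base / 2 ^ n" for n :: nat
  have d_pos: "0 < d n" for n using b base_pos by (simp add: d_def)
  show ?thesis
  proof (rule hausdorff1_le_limit)
    show "(\<lambda>n. b * diameter V + 2 * d n) \<longlonglongrightarrow> b * diameter V"
      unfolding d_def by real_asymp
    show "d \<longlonglongrightarrow> 0" unfolding d_def by real_asymp
    fix n
    \<comment> \<open>Only caps meeting the image are kept: for these the bound on
      \<open>total_stretch\<close> controls the length.\<close>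
    define J where "J = {i \<in> {1..2 ^ n}. \<exists>t\<in>V. koch_param z t \<in> koch_cap z n i}"
    have J: "finite J" by (simp add: J_def)
    have diam: "bounded (koch_cap z n i) \<and> diameter (koch_cap z n i) \<le> d n" if "i \<in> J" for i
    proof
      show "bounded (koch_cap z n i)"
        unfolding koch_cap_def by (intro compact_imp_bounded finite_imp_compact_convex_hull) simp
      obtain t where t: "i \<in> {1..2 ^ n}" "t \<in> V" "koch_param z t \<in> koch_cap z n i"
        using \<open>i \<in> J\<close> by (auto simp: J_def)
      then have reg: "koch_param z t \<in> regular_set" using V by blast
      have idx: "koch_index z n (koch_param z t) = i"
        using t reg by (intro koch_index_eq) (auto simp: regular_set_def)
      have "ennreal (stretch n (koch_param z t)) \<le> ennreal b"
        using b(2)[OF t(2)] unfolding total_stretch_def by (simp add: SUP_le_iff)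
      then have "stretch n (koch_param z t) \<le> b" using b(1) by simp
      then have "len n i * 2 ^ n \<le> base * b"
        using len_eq_stretch[OF reg, of n] base_pos unfolding idx by simp
      then have "len n i \<le> d n" by (simp add: d_def field_simps)
      then show "diameter (koch_cap z n i) \<le> d n"
        using dist_cap_le[OF t(1)] d_pos[of n] by (intro diameter_le_dist) (auto intro: order_trans)
    qed
    have cover: "koch_param z ` V \<subseteq> (\<Union>i\<in>J. koch_cap z n i)"
    proof
      fix x assume "x \<in> koch_param z ` V"
      then obtain t where t: "t \<in> V" "x = koch_param z t" by blast
      obtain i where "i \<in> {1..2 ^ n}" "koch_param z t \<in> koch_cap z n i"
        using segment_cell[of t n] t V by blast
      then show "x \<in> (\<Union>i\<in>J. koch_cap z n i)" using t by (auto simp: J_def)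
    qed
    then have "hausdorff1_pre (d n) (koch_param z ` V) \<le> (\<Sum>i\<in>J. ennreal (diameter (koch_cap z n i)))"
      using d_pos[of n] by (intro hausdorff1_pre_le_finite_cover J diam) auto
    also have "\<dots> \<le> (\<Sum>i\<in>J. ennreal (d n))" using diam by (intro sum_mono ennreal_leI) auto
    also have "\<dots> = ennreal (real (card J) * d n)"
      using d_pos[of n] by (simp add: ennreal_mult' ennreal_of_nat_eq_real_of_nat)
    also have "\<dots> \<le> ennreal (b * diameter V + 2 * d n)"
    proof (rule ennreal_leI)
      have "J \<noteq> {}" using cover False by blast
      then have J': "Min J \<in> J" "Max J \<in> J" using J by auto
      then obtain t0 t1 where t0: "Min J \<in> {1..2 ^ n}" "t0 \<in> V" "koch_param z t0 \<in> koch_cap z n (Min J)"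
        and t1: "Max J \<in> {1..2 ^ n}" "t1 \<in> V" "koch_param z t1 \<in> koch_cap z n (Max J)"
        by (auto simp: J_def)
      obtain s0 where s0: "s0 \<in> {0..1}" "t0 = point ((real (Min J) - 1 + s0) / 2 ^ n)"
        using cell_of_cap[of t0 "Min J" n] t0 V by blast
      obtain s1 where s1: "s1 \<in> {0..1}" "t1 = point ((real (Max J) - 1 + s1) / 2 ^ n)"
        using cell_of_cap[of t1 "Max J" n] t1 V by blast
      \<comment> \<open>Parameters in the cells \<open>Min J\<close> and \<open>Max J\<close> are at
        least \<open>Max J - Min J - 1\<close> cells apart, whereas up to
        \<open>Max J - Min J + 1\<close> caps are counted; the difference is the term
        \<open>2 * d n\<close>.\<close>
      have "(real (Max J) - real (Min J) - 1) / 2 ^ n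
          \<le> (real (Max J) - 1 + s1) / 2 ^ n - (real (Min J) - 1 + s0) / 2 ^ n"
        using s0(1) s1(1) unfolding diff_divide_distrib[symmetric] by (intro divide_right_mono) auto
      then have "(real (Max J) - real (Min J) - 1) / 2 ^ n * base \<le> dist t1 t0"
        unfolding s0(2) s1(2) dist_point using base_pos by (intro mult_right_mono) auto
      also have "\<dots> \<le> diameter V" using t0 t1 by (intro diameter_bounded_bound bdd)
      finally have "b * ((real (Max J) - real (Min J) - 1) / 2 ^ n * base) \<le> b * diameter V"
        using b(1) by (intro mult_left_mono) auto
      moreover have "b * ((real (Max J) - real (Min J) - 1) / 2 ^ n * base) = (real (Max J) - real (Min J) - 1) * d n"
        by (simp add: d_def)
      moreover have "(real (Max J) - real (Min J) + 1) * d n = (real (Max J) - real (Min J) - 1) * d n + 2 * d n"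
        by (simp add: algebra_simps)
      ultimately have "(real (Max J) - real (Min J) + 1) * d n \<le> b * diameter V + 2 * d n"
        by linarith
      moreover have "card J \<le> card {Min J..Max J}"
        using J by (intro card_mono) auto
      then have "real (card J) \<le> real (Max J) - real (Min J) + 1"
        using Max_ge[OF J J'(1)] by (simp add: of_nat_diff)
      then have "real (card J) * d n \<le> (real (Max J) - real (Min J) + 1) * d n"
        using d_pos[of n] by (intro mult_right_mono) auto
      ultimately show "real (card J) * d n \<le> b * diameter V + 2 * d n" by linarith
    qed
    finally show "hausdorff1_pre (d n) (koch_param z ` V) \<le> ennreal (b * diameter V + 2 * d n)" .
  qed
qed simp

lemma hausdorff1_le_nn_integral_total_stretch:
  assumes S: "S \<in> sets hausdorff1_measure" "S \<subseteq> koch_segment z 0 1" "koch_param z ` S \<subseteq> regular_set"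
    and fin: "\<And>t. t \<in> S \<Longrightarrow> total_stretch (koch_param z t) < top"
  shows "hausdorff1 (koch_param z ` S)
    \<le> (\<integral>\<^sup>+t. total_stretch (ext_param t) * indicator S t \<partial>hausdorff1_measure)"
proof -
  \<comment> \<open>The integral is written as a measure so that countable additivity sums it over
    the slices \<open>P k\<close>.\<close>
  let ?D = "density hausdorff1_measure (\<lambda>t. total_stretch (ext_param t))"
  have [measurable]: "(\<lambda>t. total_stretch (ext_param t)) \<in> borel_measurable hausdorff1_measure"
    by measurable
  have D: "emeasure ?D X = (\<integral>\<^sup>+t. total_stretch (ext_param t) * indicator X t \<partial>hausdorff1_measure)"
    if "X \<in> sets hausdorff1_measure" for X
    using that by (intro emeasure_density) auto
  have le: "hausdorff1 (koch_param z ` S) \<le> ennreal (1 + \<eta>) * emeasure ?D S" if \<eta>: "0 < \<eta>" for \<eta> :: real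
  proof -
    define u where "u t = enn2real (total_stretch (ext_param t))" for t
    define P where "P k = {t \<in> S. nat \<lfloor>u t / \<eta>\<rfloor> = k}" for k
    have [measurable]: "u \<in> borel_measurable hausdorff1_measure"
      unfolding u_def[abs_def] by measurable
    have "P k = S \<inter> {t \<in> space hausdorff1_measure. nat \<lfloor>u t / \<eta>\<rfloor> = k}" for k
      by (auto simp: P_def)
    moreover have "{t \<in> space hausdorff1_measure. nat \<lfloor>u t / \<eta>\<rfloor> = k} \<in> sets hausdorff1_measure" for k
      by measurable
    ultimately have P [measurable]: "P k \<in> sets hausdorff1_measure" for k using S(1) by simp
    have u: "total_stretch (ext_param t) = ennreal (u t)" "1 \<le> u t" if "t \<in> S" for t
    proof -
      have reg: "ext_param t \<in> regular_set" "total_stretch (ext_param t) < top"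
      proof -
        have "ext_param t = koch_param z t" using that S(2) by (intro ext_param_eq) blast
        then show "ext_param t \<in> regular_set" "total_stretch (ext_param t) < top"
          using that S(3) fin[OF that] by auto
      qed
      then show eq: "total_stretch (ext_param t) = ennreal (u t)" by (simp add: u_def less_top)
      have "ennreal 1 \<le> ennreal (u t)" using total_stretch_ge_1[OF reg(1)] eq by simp
      then show "1 \<le> u t" by (subst (asm) ennreal_le_iff) (auto simp: u_def)
    qed
    have bounds: "real k * \<eta> \<le> u t" "u t \<le> (real k + 1) * \<eta>" if "t \<in> P k" for t k
    proof -
      have "t \<in> S" "nat \<lfloor>u t / \<eta>\<rfloor> = k" using that by (auto simp: P_def)
      then have "real k = of_int \<lfloor>u t / \<eta>\<rfloor>" using u(2)[of t] \<eta> by auto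
      then have "real k \<le> u t / \<eta>" "u t / \<eta> \<le> real k + 1" by linarith+
      then show "real k * \<eta> \<le> u t" "u t \<le> (real k + 1) * \<eta>" using \<eta> by (simp_all add: field_simps)
    qed
    have step: "hausdorff1 (koch_param z ` P k) \<le> ennreal (1 + \<eta>) * emeasure ?D (P k)" for k
    proof -
      have "hausdorff1 (koch_param z ` P k) \<le> ennreal ((real k + 1) * \<eta>) * hausdorff1 (P k)"
      proof (rule hausdorff1_image_le)
        show "0 < (real k + 1) * \<eta>" using \<eta> by simp
        fix V assume V: "V \<subseteq> P k"
        have "total_stretch (koch_param z t) \<le> ennreal ((real k + 1) * \<eta>)" if "t \<in> V" for t
        proof -
          have "t \<in> S" "t \<in> P k" using V that by (auto simp: P_def)
          then show ?thesis
            using u(1)[of t] bounds(2)[of t k] subsetD[OF S(2), of t] ext_param_eq[of t]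
            by (simp add: ennreal_leI)
        qed
        moreover have "V \<subseteq> S" using V by (auto simp: P_def)
        then have "V \<subseteq> koch_segment z 0 1" "koch_param z ` V \<subseteq> regular_set"
          using S(2,3) by blast+
        ultimately show "hausdorff1 (koch_param z ` V) \<le> ennreal ((real k + 1) * \<eta> * diameter V)"
          using \<eta> by (intro hausdorff1_image_le_diameter) auto
      qed
      also have "\<dots> = (\<integral>\<^sup>+t. ennreal ((real k + 1) * \<eta>) * indicator (P k) t \<partial>hausdorff1_measure)"
        using P by (simp add: nn_integral_cmult_indicator emeasure_hausdorff1_measure)
      also have "\<dots> \<le> (\<integral>\<^sup>+t. ennreal (1 + \<eta>) * (total_stretch (ext_param t) * indicator (P k) t) \<partial>hausdorff1_measure)"
      proof (rule nn_integral_mono)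
        fix t
        show "ennreal ((real k + 1) * \<eta>) * indicator (P k) t
          \<le> ennreal (1 + \<eta>) * (total_stretch (ext_param t) * indicator (P k) t)"
        proof (cases "t \<in> P k")
          case True
          then have "t \<in> S" by (simp add: P_def)
          \<comment> \<open>Since \<open>u\<close> is at least 1 on \<open>S\<close>, the additive
            error \<eta> of the slicing is at most \<open>\<eta> * u t\<close>. It becomes a factor
            \<open>1 + \<eta>\<close>, common to all slices.\<close>
          have "(real k + 1) * \<eta> \<le> (1 + \<eta>) * u t"
            unfolding distrib_right
            using bounds(1)[OF True] mult_left_mono[OF u(2)[OF \<open>t \<in> S\<close>], of \<eta>] \<eta> by linarith
          then have "ennreal ((real k + 1) * \<eta>) \<le> ennreal (1 + \<eta>) * ennreal (u t)"
            using \<eta> by (subst ennreal_mult'[symmetric]) (auto intro: ennreal_leI)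
          then show ?thesis using True u(1)[OF \<open>t \<in> S\<close>] by simp
        qed simp
      qed
      also have "\<dots> = ennreal (1 + \<eta>) * emeasure ?D (P k)"
        unfolding D[OF P] using P by (intro nn_integral_cmult) auto
      finally show ?thesis .
    qed
    have un: "(\<Union>k. P k) = S" by (auto simp: P_def)
    have "hausdorff1 (koch_param z ` S) = hausdorff1 (\<Union>k. koch_param z ` P k)"
      by (simp add: un[symmetric] image_UN)
    also have "\<dots> \<le> (\<Sum>k. hausdorff1 (koch_param z ` P k))" by (rule hausdorff1_UN_le)
    also have "\<dots> \<le> (\<Sum>k. ennreal (1 + \<eta>) * emeasure ?D (P k))" by (intro suminf_le step) auto
    also have "\<dots> = ennreal (1 + \<eta>) * emeasure ?D (\<Union>k. P k)"
      using P by (subst suminf_emeasure[symmetric]) (auto simp: disjoint_family_on_def P_def)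
    finally show ?thesis unfolding un .
  qed
  show ?thesis
    unfolding D[OF S(1), symmetric]
  proof (rule LIMSEQ_le_const)
    let ?\<eta> = "\<lambda>n. 1 / real (Suc n)"
    have "(\<lambda>n. 1 + ?\<eta> n) \<longlonglongrightarrow> 1 + 0"
      using LIMSEQ_Suc[OF lim_1_over_n] by (intro tendsto_add tendsto_const) 
    then have "(\<lambda>n. ennreal (1 + ?\<eta> n)) \<longlonglongrightarrow> ennreal 1"
      by (intro tendsto_ennrealI) simp
    then have "(\<lambda>n. ennreal (1 + ?\<eta> n) * emeasure ?D S) \<longlonglongrightarrow> ennreal 1 * emeasure ?D S"
      by (intro tendsto_mult_ennreal tendsto_const) auto
    then show "(\<lambda>n. ennreal (1 + ?\<eta> n) * emeasure ?D S) \<longlonglongrightarrow> emeasure ?D S" by simp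
    show "\<exists>N. \<forall>n\<ge>N. hausdorff1 (koch_param z ` S) \<le> ennreal (1 + ?\<eta> n) * emeasure ?D S"
      by (intro exI[of _ 0] allI impI le) auto
  qed
qed

section \<open>Assembling the formula\<close>

lemma hausdorff1_koch_param_image:
  assumes A: "A \<in> {koch_full_set z, koch_full_set z - koch_exceptional_set z}"
    and C: "C \<in> sets hausdorff1_measure" "C \<subseteq> koch_segment z 0 1"
  shows "hausdorff1 (koch_param z ` C)
       = (\<integral>\<^sup>+t \<in> C - koch_Lambda_inv z A. koch_Pi z (koch_param z t) \<partial>hausdorff1_measure)
         + hausdorff1 (koch_param z ` C \<inter> koch_Lambda z A)"
proof -
  let ?E = "koch_exceptional_set z" and ?F = "koch_param z"
  \<comment> \<open>Parameters of vertices form a countable set because the parametrisation is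
    injective. They are negligible in the integral, and so is their image in the measure.\<close>
  define N where "N = {t \<in> koch_segment z 0 1. ?F t \<in> ?E}"
  define S where "S = {t \<in> C - N. total_stretch (ext_param t) \<noteq> top}"
  have "inj_on ?F N" using inj_on_koch_param by (rule inj_on_subset) (auto simp: N_def)
  moreover have "?F ` N \<subseteq> ?E" by (auto simp: N_def)
  then have "countable (?F ` N)" using countable_exceptional by (rule countable_subset)
  ultimately have N: "countable N" by (simp add: countable_image_inj_eq)
  have "{t} \<in> sets hausdorff1_measure" for t :: "real^2"
    using borel_subset_hausdorff1 by (rule subsetD) simp
  then have N_sets: "N \<in> sets hausdorff1_measure"
    by (rule sets.countable[OF _ N])
  then have N_null: "N \<in> null_sets hausdorff1_measure"
    using N by (intro null_setsI) (simp_all add: emeasure_hausdorff1_measure hausdorff1_countable)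
  have top_sets: "{t \<in> space hausdorff1_measure. total_stretch (ext_param t) \<noteq> top} \<in> sets hausdorff1_measure"
    by measurable
  have "S = (C - N) \<inter> {t \<in> space hausdorff1_measure. total_stretch (ext_param t) \<noteq> top}"
    by (auto simp: S_def)
  then have S_sets: "S \<in> sets hausdorff1_measure" using C(1) N_sets top_sets by auto
  have reg: "?F t \<in> regular_set" if "t \<in> C - N" for t
    using that C(2) koch_param_in_full_set[of t] by (auto simp: N_def regular_set_def)
  have S: "S \<subseteq> koch_segment z 0 1" "?F ` S \<subseteq> regular_set"
    using C(2) reg by (auto simp: S_def)
  have fin: "total_stretch (?F t) < top" if "t \<in> S" for t
    using that S(1) ext_param_eq by (auto simp: S_def less_top)
  have Lambda: "?F t \<in> koch_Lambda z A \<longleftrightarrow> total_stretch (?F t) = top" if "t \<in> C - N" for t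
    using reg[OF that] A koch_Pi_eq[OF reg[OF that]] by (auto simp: koch_Lambda_def regular_set_def)
  have "{x \<in> space borel. total_stretch x = top} \<in> sets borel" by measurable
  then have inf_sets: "{x. total_stretch x = top} \<in> sets hausdorff1_measure"
    using borel_subset_hausdorff1 by auto
  have "hausdorff1 (?F ` C) = hausdorff1 (?F ` (C - N))"
    using N by (intro hausdorff1_Un_countable[of "?F ` N"]) auto
  \<comment> \<open>The cut is made in the plane of the image, along the Borel set where
    \<open>total_stretch\<close> is infinite.\<close>
  also have "\<dots> = hausdorff1 (?F ` (C - N) \<inter> {x. total_stretch x = top})
      + hausdorff1 (?F ` (C - N) - {x. total_stretch x = top})"
    by (rule hausdorff1_split[OF inf_sets])
  also have "?F ` (C - N) - {x. total_stretch x = top} = ?F ` S"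
    using C(2) ext_param_eq by (fastforce simp: S_def)
  also have "hausdorff1 (?F ` S)
      = (\<integral>\<^sup>+t. total_stretch (ext_param t) * indicator S t \<partial>hausdorff1_measure)"
    using nn_integral_total_stretch_le[OF S_sets S fin]
      hausdorff1_le_nn_integral_total_stretch[OF S_sets S fin] by (intro antisym) auto
  also have "\<dots> = (\<integral>\<^sup>+t \<in> C - koch_Lambda_inv z A. koch_Pi z (?F t) \<partial>hausdorff1_measure)"
  proof (rule nn_integral_cong_AE)
    \<comment> \<open>Off \<open>N\<close> the two integrands agree pointwise; on \<open>N\<close>
      the index may be ambiguous, and \<open>S\<close> omits these points.\<close>
    show "AE t in hausdorff1_measure. total_stretch (ext_param t) * indicator S t
        = koch_Pi z (?F t) * indicator (C - koch_Lambda_inv z A) t"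
      using AE_not_in[OF N_null]
    proof eventually_elim
      case (elim t)
      show ?case
      proof (cases "t \<in> C")
        case True
        then have t: "t \<in> C - N" "t \<in> koch_segment z 0 1" using elim C(2) by auto
        then have "t \<in> S \<longleftrightarrow> t \<in> C - koch_Lambda_inv z A"
          using Lambda[OF t(1)] ext_param_eq[OF t(2)] by (auto simp: S_def koch_Lambda_inv_def)
        then show ?thesis
          using koch_Pi_eq[OF reg[OF t(1)]] ext_param_eq[OF t(2)] by (auto simp: indicator_def)
      qed (auto simp: S_def)
    qed
  qed
  also have "hausdorff1 (?F ` (C - N) \<inter> {x. total_stretch x = top})
      = hausdorff1 (?F ` C \<inter> koch_Lambda z A)"
    using N Lambda by (intro hausdorff1_Un_countable[of "?F ` N", symmetric]) auto
  finally show ?thesis by (simp add: add.commute)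
qed

end

theorem theorem8p7:
  fixes z :: "nat \<Rightarrow> nat \<Rightarrow> real^2" and A C :: "(real^2) set"
  assumes "koch_type_set z A"
    and "C \<in> sets hausdorff1_measure" and "C \<subseteq> koch_segment z 0 1"
  shows "hausdorff1 (koch_param z ` C)
       = (\<integral>\<^sup>+t \<in> C - koch_Lambda_inv z A. koch_Pi z (koch_param z t) \<partial>hausdorff1_measure)
         + hausdorff1 (koch_param z ` C \<inter> koch_Lambda z A)"
proof -
  interpret koch z
    using assms(1) by unfold_locales (simp add: koch_type_set_def)
  show ?thesis
    using assms by (intro hausdorff1_koch_param_image) (simp_all add: koch_type_set_def)
qed

end
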